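(* Let $\omega$ be an $A_\infty$-weight on $\mathbb{R}$. For $z=(x,y)\in\mathbb{R}^2_+$ let $I_z=(x-\tfrac y2,x+\tfrac y2)$, $I_z^-=(x-\tfrac y2,x)$, $I_z^+=(x,x+\tfrac y2)$, and $$\eta(z)=\log\frac{2^{-1}\,\omega(I_z)}{\omega(I_z^+)^{1/2}\,\omega(I_z^-)^{1/2}}\ \ (\ge 0).$$ Then $\log\omega\in \mathrm{VMO}(\mathbb{R})$ if and only if both of the following hold: (i) the measure $\eta(z)\,y^{-1}\,dx\,dy$ is a vanishing Carleson measure on $\mathbb{R}^2_+$; and (ii) the doubling weight $\omega$ is vanishing on $\mathbb{R}$.
   Context: $\mathbb{R}^2_+=\{(x,y): x\in\mathbb{R},\ y>0\}$. A weight is a locally integrable non-negative measurable function $\omega$ on $\mathbb{R}$, not almost everywhere zero; write $\omega(E)=\int_E\omega(x)\,dx$ for measurable $E\subset\mathbb{R}$, and $|E|$ for Lebesgue measure. Doubling: $\omega$ is a doubling weight if there is $\rho>0$ with $\rho^{-1}\omega(J)\le\omega(I)\le\rho\,\omega(J)$ for all adjacent bounded intervals $I,J$ with $|I|=|J|$. A doubling weight is vanishing if $\omega(I)/\omega(J)\to1$ as $|I|=|J|\to0$, uniformly over all pairs of adjacent bounded intervals $I,J$ with $|I|=|J|$ (that is, for every $\varepsilon>0$ there is $\delta>0$ such that $(1+\varepsilon)^{-1}\le \omega(x_0,x_0+t)/\omega(x_0-t,x_0)\le 1+\varepsilon$ for all $x_0\in\mathbb{R}$ and $t\in(0,\delta)$).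 $A_\infty$: $\omega$ is an $A_\infty$-weight if for every $\varepsilon>0$ there is $\delta>0$ such that, for every bounded interval $I\subset\mathbb{R}$ and measurable $E\subset I$, $|E|\le\delta|I|$ implies $\omega(E)\le\varepsilon\,\omega(I)$. It is known that every $A_\infty$-weight is doubling. BMO and VMO: $u\in L^1_{loc}(\mathbb{R})$ belongs to $\mathrm{BMO}(\mathbb{R})$ if $\sup_I\frac1{|I|}\int_I|u(x)-u_I|\,dx<\infty$, the supremum being over all bounded intervals $I\subset\mathbb{R}$, where $u_I=\frac1{|I|}\int_I u(x)\,dx$. It belongs to $\mathrm{VMO}(\mathbb{R})$ if in addition $\frac1{|I|}\int_I|u(x)-u_I|\,dx\to0$ as $|I|\to0$, uniformly in the position of $I$. Carleson measures: a positive measure $\lambda(x,y)\,dx\,dy$ on $\mathbb{R}^2_+$ is a Carleson measure if $\sup_I\frac1{|I|}\int_0^{|I|}\int_I\lambda(x,y)\,dx\,dy<\infty$, the supremum being over all bounded intervals $I\subset\mathbb{R}$. A Carleson measure is vanishing if in addition $\frac1{|I|}\int_0^{|I|}\int_I\lambda(x,y)\,dx\,dy\to0$ as $|I|\to0$, uniformly in the position of $I$. It is known that a doubling weight $\omega$ is an $A_\infty$-weight if and only if $\eta(z)\,y^{-1}\,dx\,dy$ is a Carleson measure on $\mathbb{R}^2_+$; thus under the hypothesis of the theorem this measure is always a Carleson measure. *)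

theory Defs
  imports "HOL-Analysis.Analysis"
begin

text \<open>
  Bounded intervals are nondegenerate and given by their endpoints \<open>a < b\<close>.  Whether the
  endpoints belong to the interval is immaterial, since they form a Lebesgue null set; the closed
  interval is used by default.
\<close>

definition locally_integrable :: "(real \<Rightarrow> real) \<Rightarrow> bool" where
  "locally_integrable u \<longleftrightarrow> (\<forall>K. compact K \<longrightarrow> u absolutely_integrable_on K)"

definition weight :: "(real \<Rightarrow> real) \<Rightarrow> bool" where
  "weight w \<longleftrightarrow>
     w \<in> borel_measurable lebesgue \<and> (\<forall>x. 0 \<le> w x) \<and> locally_integrable w \<and>
     \<not> (AE x in lebesgue. w x = 0)"

text \<open>
  The mass \<open>w(E)\<close>.  It is only ever applied to bounded measurable \<open>E\<close>, where it is finite for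
  every weight, so that a real-valued integral suffices.
\<close>

definition wmass :: "(real \<Rightarrow> real) \<Rightarrow> real set \<Rightarrow> real" where
  "wmass w E = (LINT x:E|lebesgue. w x)"

text \<open>Adjacent intervals of common length \<open>t\<close> are \<open>[x - t, x]\<close> and \<open>[x, x + t]\<close>.\<close>

definition doubling_weight :: "(real \<Rightarrow> real) \<Rightarrow> bool" where
  "doubling_weight w \<longleftrightarrow>
     weight w \<and>
     (\<exists>\<rho>>0. \<forall>x t. 0 < t \<longrightarrow>
        inverse \<rho> * wmass w {x..x + t} \<le> wmass w {x - t..x} \<and>
        wmass w {x - t..x} \<le> \<rho> * wmass w {x..x + t})"

definition vanishing_doubling_weight :: "(real \<Rightarrow> real) \<Rightarrow> bool" where
  "vanishing_doubling_weight w \<longleftrightarrow>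
     doubling_weight w \<and>
     (\<forall>\<epsilon>>0. \<exists>\<delta>>0. \<forall>x t. 0 < t \<and> t < \<delta> \<longrightarrow>
        inverse (1 + \<epsilon>) \<le> wmass w {x<..<x + t} / wmass w {x - t<..<x} \<and>
        wmass w {x<..<x + t} / wmass w {x - t<..<x} \<le> 1 + \<epsilon>)"

definition A_infinity_weight :: "(real \<Rightarrow> real) \<Rightarrow> bool" where
  "A_infinity_weight w \<longleftrightarrow>
     weight w \<and>
     (\<forall>\<epsilon>>0. \<exists>\<delta>>0. \<forall>a b E. a < b \<and> E \<in> sets lebesgue \<and> E \<subseteq> {a..b} \<and>
        measure lebesgue E \<le> \<delta> * (b - a) \<longrightarrow> wmass w E \<le> \<epsilon> * wmass w {a..b})"

definition mean :: "(real \<Rightarrow> real) \<Rightarrow> real \<Rightarrow> real \<Rightarrow> real" where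
  "mean u a b = (LINT x:{a..b}|lebesgue. u x) / (b - a)"

definition mean_oscillation :: "(real \<Rightarrow> real) \<Rightarrow> real \<Rightarrow> real \<Rightarrow> real" where
  "mean_oscillation u a b = mean (\<lambda>x. \<bar>u x - mean u a b\<bar>) a b"

definition BMO :: "(real \<Rightarrow> real) set" where
  "BMO = {u. locally_integrable u \<and> (\<exists>C. \<forall>a b. a < b \<longrightarrow> mean_oscillation u a b \<le> C)}"

definition VMO :: "(real \<Rightarrow> real) set" where
  "VMO = {u \<in> BMO. \<forall>\<epsilon>>0. \<exists>\<delta>>0. \<forall>a b. a < b \<and> b - a < \<delta> \<longrightarrow> mean_oscillation u a b < \<epsilon>}"

definition half_plane :: "(real \<times> real) set" where
  "half_plane = {(x, y). 0 < y}"

text \<open>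
  The measure \<open>l(x,y) dx dy\<close> on the half-plane is represented by its density \<open>l\<close>, whose values
  off the half-plane are irrelevant.  The normalised mass of a Carleson box may be infinite a
  priori, hence the type \<^typ>\<open>ennreal\<close>.
\<close>

definition carleson_average :: "(real \<times> real \<Rightarrow> real) \<Rightarrow> real \<Rightarrow> real \<Rightarrow> ennreal" where
  "carleson_average l a b =
     (\<integral>\<^sup>+z\<in>{a..b} \<times> {0<..<b - a}. ennreal (l z) \<partial>lebesgue) / ennreal (b - a)"

definition carleson_measure :: "(real \<times> real \<Rightarrow> real) \<Rightarrow> bool" where
  "carleson_measure l \<longleftrightarrow>
     l \<in> borel_measurable (lebesgue_on half_plane) \<and> (\<forall>z\<in>half_plane. 0 \<le> l z) \<and>
     (SUP (a, b)\<in>{(a, b). a < b}. carleson_average l a b) < \<infinity>"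

definition vanishing_carleson_measure :: "(real \<times> real \<Rightarrow> real) \<Rightarrow> bool" where
  "vanishing_carleson_measure l \<longleftrightarrow>
     carleson_measure l \<and>
     (\<forall>\<epsilon>::real>0. \<exists>\<delta>>0. \<forall>a b. a < b \<and> b - a < \<delta> \<longrightarrow> carleson_average l a b < ennreal \<epsilon>)"

definition eta :: "(real \<Rightarrow> real) \<Rightarrow> real \<times> real \<Rightarrow> real" where
  "eta w = (\<lambda>(x, y).
     ln (inverse 2 * wmass w {x - y / 2<..<x + y / 2} /
         (wmass w {x<..<x + y / 2} powr (1 / 2) * wmass w {x - y / 2<..<x} powr (1 / 2))))"

end

theory Submission
  imports Defs
begin

text \<open>
  Let \<open>W\<close> be a primitive of the weight \<open>w\<close>, and let \<open>l(x,y)\<close> be the logarithm of the mean of \<open>w\<close> over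
  the interval with centre \<open>x\<close> and length \<open>y\<close>.  Halving this interval shows that
  \<open>\<eta>(x,y) = l(x,y) - (l(x - y/4, y/2) + l(x + y/4, y/2)) / 2\<close>: the density \<open>\<eta>\<close> is the defect of Jensen's
  inequality for the logarithm in one halving step.  Fix an interval \<open>I\<close>, put
  \<open>G(y) = \<integral>\<^sub>I l(x,y) dx\<close>, and let \<open>d\<close> bound the differences of \<open>l\<close> between neighbouring intervals of
  comparable length at most \<open>|I|\<close>.  In \<open>\<integral>\<^sub>I \<eta>(x,y) dx\<close> the two shifts by \<open>y/4\<close> change the integral only
  near the endpoints of \<open>I\<close>, so this integral is \<open>G(y) - G(y/2) + O(d y)\<close>.  Integrated against \<open>dy/y\<close>
  it telescopes over the scales, and the Carleson average of \<open>\<eta>(x,y)/y\<close> over \<open>I\<close> equals \<open>ln 2\<close> times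
  the Jensen gap \<open>log (mean of w) - mean of (log w)\<close> on \<open>I\<close>, up to \<open>O(d)\<close>; the version truncated at
  a positive scale is \<open>truncated_defect_integral\<close>.  Both implications rest on this identity.

  Suppose that \<open>log w\<close> has small mean oscillation.  The values of \<open>log w\<close> far from its mean over \<open>I\<close> lie in a
  small proportion of \<open>I\<close>, and the \<open>A\<^sub>\<infinity>\<close> condition says that little mass of \<open>w\<close> sits there.  Hence the
  Jensen gap is small (\<open>A_infinity_jensen_gap_le\<close>); small gap and small oscillation make \<open>d\<close> small
  (\<open>slowly_varying_of_jensen_gap\<close>), which contains the doubling property, and the identity bounds the
  Carleson averages (\<open>carleson_average_le_of_gap\<close>).

  Conversely, doubling with constant close to 1 makes \<open>d\<close> small (\<open>slowly_varying_of_ratios\<close>).  The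
  Jensen gap is the mean of \<open>e\<^sup>g - 1 - g\<close> with \<open>g = log w - l(I)\<close>.  The identity bounds the
  corresponding means at positive scales, where \<open>w\<close> is replaced by its averages; as the integrand is
  nonnegative, Lebesgue differentiation and Fatou's lemma transfer the bound to \<open>w\<close> itself
  (\<open>nn_integral_deviation_le\<close>), which also yields the integrability of \<open>log w\<close>.  Since
  \<open>e\<^sup>g - 1 - g\<close> dominates \<open>|g|\<close> up to small errors, the mean oscillation of \<open>log w\<close> is small
  (\<open>oscillation_of_carleson_average\<close>).

  Every estimate holds on each interval with explicit constants.  Used on all intervals with some
  constant they give the global bounds (BMO, Carleson, doubling), and used on short intervals with small
  constants they give the vanishing ones.
\<close>

section \<open>Primitives of locally integrable functions\<close>

text \<open>
  Normalised to vanish at \<open>0\<close>; for each \<open>x\<close> one of the two intervals is empty or degenerate, so that this is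
  the oriented integral from \<open>0\<close> to \<open>x\<close>.
\<close>
definition primitive :: "(real \<Rightarrow> real) \<Rightarrow> real \<Rightarrow> real" where
  "primitive f x = integral {0..x} f - integral {x..0} f"

lemma locally_integrableD:
  assumes "locally_integrable f"
  shows "set_integrable lebesgue {a..b} f" "f integrable_on {a..b}"
  using assms absolutely_integrable_on_def unfolding locally_integrable_def by (blast intro: compact_Icc)+

lemma continuous_imp_locally_integrable:
  "continuous_on UNIV f \<Longrightarrow> locally_integrable f"
  unfolding locally_integrable_def
  by (metis absolutely_integrable_continuous bounded_subset_cbox_symmetric compact_imp_bounded continuous_on_subset
      lmeasurable_compact fmeasurableD set_integrable_subset top_greatest)

lemma integral_eq_primitive:
  assumes f: "locally_integrable f" and "x \<le> y"
  shows "integral {x..y} f = primitive f y - primitive f x"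
proof -
  have i: "f integrable_on {p..q}" for p q
    using f by (rule locally_integrableD)
  have c: "integral {p..q} f + integral {q..r} f = integral {p..r} f" if "p \<le> q" "q \<le> r" for p q r
    using that i by (intro Henstock_Kurzweil_Integration.integral_combine)
  have z: "integral {p..q} f = 0" if "q \<le> p" for p q
    using that by (cases "p = q") auto
  consider "0 \<le> x" | "x \<le> 0" "0 \<le> y" | "y \<le> 0" by linarith
  then show ?thesis
    using c[of 0 x y] c[of x 0 y] c[of x y 0] z[of x 0] z[of y 0] z[of 0 x] z[of 0 y] \<open>x \<le> y\<close>
    unfolding primitive_def by cases auto
qed

lemma continuous_primitive:
  assumes f: "locally_integrable f"
  shows "continuous_on UNIV (primitive f)"
proof -
  have "isCont (primitive f) x" for x
  proof -
    have "continuous_on {x-1..x+1} (\<lambda>y. primitive f (x-1) + integral {x-1..y} f)"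
      by (intro continuous_intros indefinite_integral_continuous_1 locally_integrableD[OF f])
    then have "continuous_on {x-1..x+1} (primitive f)"
      by (rule continuous_on_eq) (auto simp: integral_eq_primitive[OF f])
    then have "continuous_on {x-1<..<x+1} (primitive f)"
      by (rule continuous_on_subset) auto
    then show ?thesis
      by (simp add: continuous_on_eq_continuous_at)
  qed
  then show ?thesis by (simp add: continuous_at_imp_continuous_on)
qed

lemma AE_right_difference_quotient:
  assumes f: "\<And>a b. f integrable_on {a..b::real}"
  shows "\<exists>N. negligible N \<and>
    (\<forall>x. x \<notin> N \<longrightarrow> ((\<lambda>h. integral {x..x+h} f / h) \<longlongrightarrow> f x) (at_right (0::real)))"
proof (rule integrable_ccontinuous_explicit[of f])
  show "f integrable_on cbox a b" for a b using f by simp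
next
  fix N
  assume N: "negligible N" "\<And>x e. \<lbrakk>x \<notin> N; 0 < e\<rbrakk> \<Longrightarrow>
               \<exists>d>0. \<forall>h. 0 < h \<and> h < d \<longrightarrow>
                         norm(integral (cbox x (x + h *\<^sub>R One)) f /\<^sub>R h ^ DIM(real) - f x) < e"
  have "((\<lambda>h. integral {x..x+h} f / h) \<longlongrightarrow> f x) (at_right 0)" if "x \<notin> N" for x
  proof (rule tendstoI)
    fix e :: real assume "0 < e"
    from N(2)[OF that this] obtain d where "d > 0"
      "\<And>h. 0 < h \<Longrightarrow> h < d \<Longrightarrow> \<bar>integral {x..x+h} f / h - f x\<bar> < e"
      by (auto simp: divide_inverse mult.commute)
    then show "\<forall>\<^sub>F h in at_right 0. dist (integral {x..x+h} f / h) (f x) < e"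
      unfolding eventually_at_right_field dist_real_def by blast
  qed
  with N(1) show ?thesis by blast
qed

text \<open>
  Lebesgue differentiation for averages over intervals starting at the point gives the right
  derivative; the left derivative is the right one of the reflected function.
\<close>
lemma AE_primitive_has_derivative:
  assumes f: "locally_integrable f"
  shows "AE x in lebesgue. (primitive f has_real_derivative f x) (at x)"
proof -
  have i: "f integrable_on {a..b}" for a b by (rule locally_integrableD[OF f])
  have i': "(\<lambda>x. f (- x)) integrable_on {a..b}" for a b
    using i[of "-b" "-a"] Henstock_Kurzweil_Integration.integrable_reflect_real[where f=f and a="-b" and b="-a"] by simp
  obtain N where N: "negligible N"
    "\<And>x. x \<notin> N \<Longrightarrow> ((\<lambda>h. integral {x..x+h} f / h) \<longlongrightarrow> f x) (at_right 0)"
    using AE_right_difference_quotient[OF i] by blast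
  obtain M where M: "negligible M"
    "\<And>x. x \<notin> M \<Longrightarrow> ((\<lambda>h. integral {x..x+h} (\<lambda>x. f (- x)) / h) \<longlongrightarrow> f (- x)) (at_right 0)"
    using AE_right_difference_quotient[OF i'] by blast
  have "negligible (uminus ` M)"
    using M(1) by (intro negligible_differentiable_image_negligible) (auto intro!: derivative_intros)
  then have "negligible (N \<union> uminus ` M)" using N(1) by auto
  moreover have "(primitive f has_real_derivative f x) (at x)" if "x \<notin> N \<union> uminus ` M" for x
  proof -
    let ?q = "\<lambda>h. (primitive f (x + h) - primitive f x) / h"
    have "((\<lambda>h. integral {x..x+h} f / h) \<longlongrightarrow> f x) (at_right 0)"
      using that N(2) by auto
    then have r: "(?q \<longlongrightarrow> f x) (at_right 0)"
      by (rule Lim_transform_eventually)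
         (auto simp: eventually_at_filter integral_eq_primitive[OF f])
    have "- x \<notin> M" using that by force
    from M(2)[OF this] have "((\<lambda>h. integral {-x..-x+h} (\<lambda>x. f (- x)) / h) \<longlongrightarrow> f x) (at_right 0)"
      by simp
    then have "((\<lambda>h. ?q (- h)) \<longlongrightarrow> f x) (at_right 0)"
    proof (rule Lim_transform_eventually)
      have "integral {-x..-x+h} (\<lambda>x. f (- x)) / h = ?q (- h)" if "0 < h" for h
        using that Henstock_Kurzweil_Integration.integral_reflect_real[where f=f and a="x-h" and b=x] 
        by (simp add: integral_eq_primitive[OF f] minus_divide_left)
      then show "\<forall>\<^sub>F h in at_right 0. integral {-x..-x+h} (\<lambda>x. f (- x)) / h = ?q (- h)"
        by (simp add: eventually_at_filter)
    qed
    then have "(?q \<longlongrightarrow> f x) (at_left 0)"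
      by (simp add: filterlim_at_left_to_right)
    with r show ?thesis
      unfolding DERIV_def by (simp add: filterlim_split_at)
  qed
  ultimately show ?thesis
    by (intro AE_I'[of "N \<union> uminus ` M"]) (auto simp: negligible_iff_null_sets)
qed

lemma has_derivative_symmetric_quotient:
  assumes "(F has_real_derivative D) (at x)"
  shows "((\<lambda>r. (F (x + r / 2) - F (x - r / 2)) / r) \<longlongrightarrow> D) (at_right 0)"
proof -
  have q: "((\<lambda>h. (F (x + h) - F x) / h) \<longlongrightarrow> D) (at 0)"
    using assms by (simp add: DERIV_def)
  have 1: "filterlim (\<lambda>r::real. r / 2) (at 0) (at_right 0)"
    and 2: "filterlim (\<lambda>r::real. - r / 2) (at 0) (at_right 0)"
    by (auto simp: filterlim_at eventually_at_filter intro!: tendsto_eq_intros)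
  have "((\<lambda>r. ((F (x + r / 2) - F x) / (r / 2) + (F (x + - r / 2) - F x) / (- r / 2)) / 2)
          \<longlongrightarrow> (D + D) / 2) (at_right 0)"
    by (intro tendsto_intros filterlim_compose[OF q 1] filterlim_compose[OF q 2]) simp
  then have "((\<lambda>r. (F (x + r / 2) - F (x - r / 2)) / r) \<longlongrightarrow> (D + D) / 2) (at_right 0)"
    by (rule Lim_transform_eventually) (auto simp: eventually_at_filter field_simps)
  then show ?thesis by simp
qed

section \<open>Logarithmic means of an increasing function\<close>

text \<open>
  If \<open>A\<close> is a primitive of \<open>w\<close>, this is the logarithm of the mean of \<open>w\<close> over the interval with
  centre \<open>x\<close> and length \<open>y\<close>.
\<close>
definition log_mean :: "(real \<Rightarrow> real) \<Rightarrow> real \<Rightarrow> real \<Rightarrow> real" where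
  "log_mean A x y = ln ((A (x + y / 2) - A (x - y / 2)) / y)"

text \<open>
  For a primitive \<open>A\<close> of the weight \<open>w\<close> this is \<open>eta w (x, y)\<close>.
\<close>
definition defect :: "(real \<Rightarrow> real) \<Rightarrow> real \<Rightarrow> real \<Rightarrow> real" where
  "defect A x y =
     log_mean A x y - (log_mean A (x - y / 4) (y / 2) + log_mean A (x + y / 4) (y / 2)) / 2"

text \<open>
  The comparisons made below are between the interval with centre \<open>x\<close> and length \<open>y\<close> and one
  at least half and at most as long, whose centre is at distance at most \<open>y\<close>.
\<close>
definition slowly_varying :: "(real \<Rightarrow> real) \<Rightarrow> real \<Rightarrow> real \<Rightarrow> bool" where
  "slowly_varying A h d \<longleftrightarrow>
     (\<forall>x x' y y'. 0 < y \<and> y \<le> h \<and> y / 2 \<le> y' \<and> y' \<le> y \<and> \<bar>x - x'\<bar> \<le> y \<longrightarrow>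
        \<bar>log_mean A x y - log_mean A x' y'\<bar> \<le> d)"

lemma slowly_varyingD:
  assumes "slowly_varying A h d" "0 < y" "y \<le> h" "y / 2 \<le> y'" "y' \<le> y" "\<bar>x - x'\<bar> \<le> y"
  shows "\<bar>log_mean A x y - log_mean A x' y'\<bar> \<le> d"
  using assms unfolding slowly_varying_def by blast

context
  fixes A :: "real \<Rightarrow> real"
  assumes mono: "strict_mono A" and cont: "continuous_on UNIV A"
begin

lemma increment_pos: "x < y \<Longrightarrow> 0 < A y - A x"
  using mono by (simp add: strict_mono_def)

lemma continuous_on_A:
  "continuous_on S f \<Longrightarrow> continuous_on S (\<lambda>z. A (f z))"
  by (rule continuous_on_compose2[OF cont]) auto

lemma continuous_on_log_mean [continuous_intros]:
  fixes f g :: "'a::topological_space \<Rightarrow> real"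
  assumes "continuous_on S f" "continuous_on S g" "\<And>z. z \<in> S \<Longrightarrow> 0 < g z"
  shows "continuous_on S (\<lambda>z. log_mean A (f z) (g z))"
proof -
  have "(A (f z + g z / 2) - A (f z - g z / 2)) / g z \<noteq> 0" "g z \<noteq> 0" if "z \<in> S" for z
    using assms(3)[OF that] increment_pos[of "f z - g z / 2" "f z + g z / 2"] by auto
  then show ?thesis
    unfolding log_mean_def by (intro continuous_intros continuous_on_A assms(1,2)) auto
qed

lemma continuous_on_defect [continuous_intros]:
  fixes f g :: "'a::topological_space \<Rightarrow> real"
  assumes "continuous_on S f" "continuous_on S g" "\<And>z. z \<in> S \<Longrightarrow> 0 < g z"
  shows "continuous_on S (\<lambda>z. defect A (f z) (g z))"
  unfolding defect_def using assms by (intro continuous_intros) auto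

lemma exp_log_mean:
  assumes "0 < y"
  shows "exp (log_mean A x y) = (A (x + y / 2) - A (x - y / 2)) / y"
  using assms increment_pos[of "x - y/2" "x + y/2"] by (simp add: log_mean_def)

lemma defect_nonneg:
  assumes "0 < y"
  shows "0 \<le> defect A x y"
proof -
  define p where "p = exp (log_mean A (x - y / 4) (y / 2) / 2)"
  define q where "q = exp (log_mean A (x + y / 4) (y / 2) / 2)"
  have p2: "p ^ 2 = (A x - A (x - y / 2)) / (y / 2)" and q2: "q ^ 2 = (A (x + y / 2) - A x) / (y / 2)"
    using assms exp_log_mean[of "y/2" "x - y/4"] exp_log_mean[of "y/2" "x + y/4"]
    by (simp_all add: p_def q_def add.commute flip: exp_of_nat_mult)
  have "p * q \<le> (p ^ 2 + q ^ 2) / 2"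
    using sum_squares_bound[of p q] by simp
  also have "\<dots> = (A (x + y / 2) - A (x - y / 2)) / y"
    unfolding p2 q2 using assms by (simp add: field_simps)
  finally have "ln (p * q) \<le> log_mean A x y"
    unfolding log_mean_def by (intro ln_mono) (auto simp: p_def q_def)
  then show ?thesis
    by (simp add: defect_def p_def q_def ln_mult)
qed

text \<open>
  Both halves of the interval at \<open>(x, y)\<close> are intervals of length \<open>y / 2\<close> whose centres are \<open>x\<close> shifted
  by \<open>y / 4\<close>.  After translation the two integrals differ from the unshifted one only over pieces
  of length \<open>y / 4\<close> near \<open>a\<close> and \<open>b\<close>, where slow variation makes the contributions nearly cancel.
\<close>
lemma integral_defect_layer:
  assumes sv: "slowly_varying A h d" and y: "0 < y" "y \<le> h" and ab: "a \<le> b"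
  shows "\<bar>integral {a..b} (\<lambda>x. defect A x y) -
          (integral {a..b} (\<lambda>x. log_mean A x y) - integral {a..b} (\<lambda>x. log_mean A x (y / 2)))\<bar>
         \<le> d * y / 4"
proof -
  define f where "f = (\<lambda>x. log_mean A x (y / 2))"
  define F where "F = primitive f"
  have cf: "continuous_on S f" for S
    unfolding f_def using y by (intro continuous_intros) auto
  note if' = integrable_continuous_real[OF cf]
  have F: "integral {p..q} f = F q - F p" if "p \<le> q" for p q
    unfolding F_def using that by (intro integral_eq_primitive continuous_imp_locally_integrable cf)
  have shift: "integral {p..q} (\<lambda>x. f (x + c)) = F (q + c) - F (p + c)" if "p \<le> q" for p q c
    using F[of "p + c" "q + c"] integral_shift_real_ivl[of "p + c" c "q + c" f] that by simp
  have ishift: "(\<lambda>x. f (x + c)) integrable_on {p..q}" for p q c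
    by (intro integrable_continuous_real continuous_on_compose2[OF cf[of UNIV]] continuous_intros) auto
  \<comment> \<open>The second difference of \<open>F\<close> is an integral of increments of \<open>f\<close> over a shift by \<open>y / 4\<close>.\<close>
  have diff: "\<bar>(F (p + y / 4) - F p) - (F p - F (p - y / 4))\<bar> \<le> d * (y / 4)" for p
  proof -
    have "(F (p + y / 4) - F p) - (F p - F (p - y / 4))
        = integral {p - y / 4..p} (\<lambda>x. f (x + y / 4) - f x)"
      using y shift[of "p - y / 4" p "y / 4"] F[of "p - y / 4" p]
      by (simp add: Henstock_Kurzweil_Integration.integral_diff ishift if')
    also have "\<bar>\<dots>\<bar> \<le> d * (p - (p - y / 4))"
    proof -
      have "continuous_on {p - y / 4..p} (\<lambda>x. f (x + y / 4) - f x)"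
        by (intro continuous_intros cf continuous_on_compose2[OF cf[of UNIV]]) auto
      moreover have "\<bar>f (x + y / 4) - f x\<bar> \<le> d" for x
        unfolding f_def using y by (intro slowly_varyingD[OF sv]) auto
      ultimately show ?thesis
        using integral_bound[of "p - y / 4" p "\<lambda>x. f (x + y / 4) - f x" d] y by simp
    qed
    finally show ?thesis by simp
  qed
  have il: "(\<lambda>x. log_mean A x y) integrable_on {a..b}"
    using y by (intro integrable_continuous_real continuous_intros) auto
  have "integral {a..b} (\<lambda>x. defect A x y)
      = integral {a..b} (\<lambda>x. log_mean A x y) -
        (integral {a..b} (\<lambda>x. f (x + - (y / 4))) + integral {a..b} (\<lambda>x. f (x + y / 4))) / 2"
    unfolding defect_def using ishift[of "- (y / 4)" a b] ishift[of "y / 4" a b] il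
    by (simp add: f_def Henstock_Kurzweil_Integration.integral_diff
        Henstock_Kurzweil_Integration.integral_add integrable_add)
  also have "\<dots> = integral {a..b} (\<lambda>x. log_mean A x y) -
        (F (b - y / 4) - F (a - y / 4) + (F (b + y / 4) - F (a + y / 4))) / 2"
    using ab by (simp only: shift) simp
  finally have "integral {a..b} (\<lambda>x. defect A x y) -
      (integral {a..b} (\<lambda>x. log_mean A x y) - integral {a..b} f)
    = (((F (a + y / 4) - F a) - (F a - F (a - y / 4))) -
       ((F (b + y / 4) - F b) - (F b - F (b - y / 4)))) / 2"
    using F[OF ab] by (simp add: field_simps)
  also have "\<bar>\<dots>\<bar> \<le> d * y / 4"
  proof -
    have "\<bar>(p - q) / 2\<bar> \<le> c" if "\<bar>p\<bar> \<le> c" "\<bar>q\<bar> \<le> c" for p q c :: real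
      using that by (auto simp: abs_le_iff field_simps)
    from this[OF diff diff] show ?thesis by simp
  qed
  finally show ?thesis unfolding f_def .
qed

end

text \<open>
  The measure \<open>dy / y\<close> is invariant under dilation, so the difference telescopes over scales.
\<close>
lemma integral_dilation_difference:
  fixes G :: "real \<Rightarrow> real"
  assumes G: "continuous_on {0<..} G" and e: "0 < e" "e \<le> h"
  shows "integral {e..h} (\<lambda>y. (G y - G (y / 2)) / y)
       = integral {h / 2..h} (\<lambda>y. G y / y) - integral {e / 2..e} (\<lambda>y. G y / y)"
proof -
  let ?f = "\<lambda>y. G y / y"
  have i: "?f integrable_on {p..q}" if "0 < p" for p q
  proof -
    have "continuous_on {p..q} G"
      using that by (intro continuous_on_subset[OF G]) auto
    then show ?thesis
      using that by (intro integrable_continuous_real continuous_on_divide continuous_on_id) auto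
  qed
  have "(?f has_integral integral {e / 2..h / 2} ?f) {e / 2..h / 2}"
    using e i by (intro integrable_integral) auto
  then have "((\<lambda>y. ?f (1 / 2 * y)) has_integral (1 / \<bar>1 / 2\<bar>) *\<^sub>R integral {e / 2..h / 2} ?f)
               ((\<lambda>x. x / (1 / 2)) ` {e / 2..h / 2})"
    by (intro has_integral_stretch_real) auto
  then have "((\<lambda>y. ?f (y / 2)) has_integral 2 * integral {e / 2..h / 2} ?f) {e..h}"
    by (simp add: mult.commute[of _ 2] image_mult_atLeastAtMost)
  then have "((\<lambda>y. (1/2) * ?f (y / 2)) has_integral (1/2) * (2 * integral {e / 2..h / 2} ?f)) {e..h}"
    by (rule has_integral_mult_right)
  then have s: "((\<lambda>y. G (y / 2) / y) has_integral integral {e / 2..h / 2} ?f) {e..h}"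
    by simp
  have "integral {e..h} (\<lambda>y. (G y - G (y / 2)) / y) = integral {e..h} ?f - integral {e / 2..h / 2} ?f"
    using has_integral_diff[OF integrable_integral[OF i[of e h]] s] e
    by (simp add: diff_divide_distrib integral_unique)
  moreover have "integral {e / 2..e} ?f + integral {e..h} ?f = integral {e / 2..h} ?f"
    using e by (intro Henstock_Kurzweil_Integration.integral_combine i) auto
  moreover have "integral {e / 2..h / 2} ?f + integral {h / 2..h} ?f = integral {e / 2..h} ?f"
    using e by (intro Henstock_Kurzweil_Integration.integral_combine i) auto
  ultimately show ?thesis by linarith
qed

lemma integral_inverse_half: "0 < (h::real) \<Longrightarrow> ((\<lambda>y. 1 / y) has_integral ln 2) {h / 2..h}"
proof -
  assume h: "0 < h"
  have "((\<lambda>y. 1 / y) has_integral ln h - ln (h / 2)) {h / 2..h}"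
    using h by (intro fundamental_theorem_of_calculus)
      (auto intro!: derivative_eq_intros simp: has_real_derivative_iff_has_vector_derivative[symmetric])
  then show ?thesis using h by (simp add: ln_div)
qed

section \<open>Slow variation of the logarithmic means of a doubling measure\<close>

context
  fixes A :: "real \<Rightarrow> real"
  assumes mono: "strict_mono A" and cont: "continuous_on UNIV A"
begin

lemma grid_increment_bounds:
  assumes "\<And>k. k < N \<Longrightarrow> m \<le> A (p + real (Suc k) * t) - A (p + real k * t)"
    and "\<And>k. k < N \<Longrightarrow> A (p + real (Suc k) * t) - A (p + real k * t) \<le> M"
    and "i \<le> j" "j \<le> N"
  shows "(real j - real i) * m \<le> A (p + real j * t) - A (p + real i * t)"
    and "A (p + real j * t) - A (p + real i * t) \<le> (real j - real i) * M"
proof -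
  have "(real j - real i) * m \<le> A (p + real j * t) - A (p + real i * t) \<and>
        A (p + real j * t) - A (p + real i * t) \<le> (real j - real i) * M"
    using assms(3,4)
  proof (induction j rule: dec_induct)
    case (step n)
    then show ?case
      using assms(1)[of n] assms(2)[of n] by (simp add: algebra_simps)
  qed simp
  then show "(real j - real i) * m \<le> A (p + real j * t) - A (p + real i * t)"
    "A (p + real j * t) - A (p + real i * t) \<le> (real j - real i) * M" by auto
qed

text \<open>
  Cut an interval into \<open>N\<close> cells of length \<open>t\<close>.  Neighbouring cells have masses comparable up to
  \<open>exp d\<close>, hence any two up to \<open>exp (N * d)\<close>.  A subinterval of length \<open>k * t\<close> contains at least \<open>k - 2\<close> and
  meets at most \<open>k + 2\<close> cells; as \<open>k \<ge> N / 6\<close>, the error \<open>2 / k\<close> is at most \<open>12 / N\<close>.  The resulting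
  bound becomes small if first \<open>N\<close> is taken large and then \<open>d\<close> small.
\<close>
lemma log_mean_near_grid_cell:
  fixes N :: nat
  assumes N: "12 < N" and t: "0 < t" and d: "0 \<le> d"
    and ratio: "\<And>x. \<bar>ln (A (x + t) - A x) - ln (A x - A (x - t))\<bar> \<le> d"
    and l: "real N * t / 6 \<le> l" and c: "p + l / 2 \<le> c" "c + l / 2 \<le> p + real N * t"
  shows "\<bar>log_mean A c l - ln ((A (p + t) - A p) / t)\<bar> \<le> real N * d - ln (1 - 12 / real N)"
proof -
  define v where "v = (\<lambda>k::nat. A (p + real (Suc k) * t) - A (p + real k * t))"
  have v_pos: "0 < v k" for k
    using t mono by (auto simp: v_def strict_mono_def intro!: mult_strict_right_mono)
  have v_near: "\<bar>ln (v k) - ln (v 0)\<bar> \<le> real k * d" for k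
  proof (induction k)
    case (Suc k)
    have "\<bar>ln (v (Suc k)) - ln (v k)\<bar> \<le> d"
      using ratio[of "p + real (Suc k) * t"] by (simp add: v_def algebra_simps)
    with Suc show ?case by (simp add: algebra_simps)
  qed simp
  define E where "E = exp (real N * d)"
  have v_le: "v k \<le> E * v 0" and v_ge: "v 0 / E \<le> v k" if "k < N" for k
  proof -
    have "\<bar>ln (v k) - ln (v 0)\<bar> \<le> real N * d"
      using v_near[of k] mult_right_mono[of "real k" "real N" d] d that by linarith
    then have "ln (v k) \<le> real N * d + ln (v 0)" "ln (v 0) \<le> real N * d + ln (v k)" by linarith+
    then have "ln (v k) \<le> ln (E * v 0)" "ln (v 0) \<le> ln (E * v k)"
      using v_pos[of 0] v_pos[of k] by (simp_all add: E_def ln_mult)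
    then show "v k \<le> E * v 0" "v 0 / E \<le> v k"
      using v_pos[of 0] v_pos[of k] by (simp_all add: E_def field_simps)
  qed
  define s where "s = c - l / 2"
  define u where "u = c + l / 2"
  have l_pos: "0 < l" using l t N by (intro less_le_trans[OF _ l]) simp
  have su: "p \<le> s" "s < u" "u \<le> p + real N * t" "u - s = l"
    using c l_pos by (auto simp: s_def u_def)
  define k where "k = l / t"
  have k: "real N / 6 \<le> k" using l t by (simp add: k_def field_simps)
  have up: "A u - A s \<le> (k + 2) * (E * v 0)"
  proof -
    define i where "i = nat \<lfloor>(s - p) / t\<rfloor>"
    define j where "j = nat \<lceil>(u - p) / t\<rceil>"
    have i: "real i \<le> (s - p) / t" "(s - p) / t - 1 < real i"
      using su t by (auto simp: i_def)
    have j: "(u - p) / t \<le> real j" "real j < (u - p) / t + 1"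
      using su t by (auto simp: j_def) linarith+
    have kk: "(u - p) / t - (s - p) / t = k" using su by (simp add: k_def flip: diff_divide_distrib)
    have "(u - p) / t \<le> real N" using su t by (simp add: field_simps)
    then have "j \<le> N" by (simp add: j_def ceiling_le_iff nat_le_iff)
    moreover have "i \<le> j"
    proof -
      have "real i < real j + 1" using i j kk k N by linarith
      then show ?thesis by linarith
    qed
    ultimately have "A (p + real j * t) - A (p + real i * t) \<le> (real j - real i) * (E * v 0)"
      using v_le less_imp_le[OF v_pos]
      by (intro grid_increment_bounds(2)[of N 0]) (auto simp: v_def simp del: of_nat_Suc)
    moreover have "p + real i * t \<le> s" "u \<le> p + real j * t"
      using i(1) j(1) t by (simp_all add: field_simps)
    then have "A (p + real i * t) \<le> A s" "A u \<le> A (p + real j * t)"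
      using mono by (simp_all add: strict_mono_less_eq)
    moreover have "(real j - real i) * (E * v 0) \<le> (k + 2) * (E * v 0)"
      using i j kk v_pos[of 0] by (intro mult_right_mono) (auto simp: E_def)
    ultimately show ?thesis by linarith
  qed
  have lo: "(k - 2) * (v 0 / E) \<le> A u - A s"
  proof -
    define i where "i = nat \<lceil>(s - p) / t\<rceil>"
    define j where "j = nat \<lfloor>(u - p) / t\<rfloor>"
    have i: "(s - p) / t \<le> real i" "real i < (s - p) / t + 1"
      using su t by (auto simp: i_def) linarith+
    have j: "real j \<le> (u - p) / t" "(u - p) / t - 1 < real j"
      using su t by (auto simp: j_def)
    have kk: "(u - p) / t - (s - p) / t = k" using su by (simp add: k_def flip: diff_divide_distrib)
    have "(u - p) / t \<le> real N" using su t by (simp add: field_simps)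
    then have "j \<le> N" using j by linarith
    moreover have "i \<le> j"
    proof -
      have "real i < real j + 1" using i j kk k N by linarith
      then show ?thesis by linarith
    qed
    ultimately have "(real j - real i) * (v 0 / E) \<le> A (p + real j * t) - A (p + real i * t)"
      using v_ge v_le by (intro grid_increment_bounds(1)[of N _ _ _ "E * v 0"]) (auto simp: v_def simp del: of_nat_Suc)
    moreover have "s \<le> p + real i * t" "p + real j * t \<le> u"
      using i(1) j(1) t by (simp_all add: field_simps)
    then have "A s \<le> A (p + real i * t)" "A (p + real j * t) \<le> A u"
      using mono by (simp_all add: strict_mono_less_eq)
    moreover have "(k - 2) * (v 0 / E) \<le> (real j - real i) * (v 0 / E)"
      using i j kk v_pos[of 0] by (intro mult_right_mono) (auto simp: E_def)
    ultimately show ?thesis by linarith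
  qed
  define q where "q = 1 - 12 / real N"
  have q: "0 < q" "q < 1" using N by (auto simp: q_def)
  have k0: "0 < k" using k N by linarith
  have kq: "k * q \<le> k - 2"
    using k N mult_left_mono[OF k, of "12 / real N"] by (simp add: q_def algebra_simps)
  have kq': "(k + 2) * q \<le> k"
  proof -
    have "(k + 2) * q \<le> k * q + 2 * 1"
      using q by (simp add: distrib_right)
    with kq show ?thesis by simp
  qed
  have m: "log_mean A c l = ln ((A u - A s) / (k * t))"
    using t by (simp add: log_mean_def k_def s_def u_def)
  have Aus: "0 < A u - A s" using mono su by (simp add: strict_mono_def)
  have 1: "(A u - A s) / (k * t) \<le> E * (v 0 / t) / q"
  proof -
    have "(A u - A s) * q \<le> (k + 2) * (E * v 0) * q"
      using up q by (intro mult_right_mono) auto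
    also have "\<dots> \<le> k * (E * v 0)"
      using mult_right_mono[OF kq', of "E * v 0"] v_pos[of 0] by (simp add: E_def mult_ac)
    finally have "(A u - A s) * q / (k * t * q) \<le> k * (E * v 0) / (k * t * q)"
      using k0 t q by (intro divide_right_mono) auto
    then show ?thesis using k0 t q by simp
  qed
  have 2: "(v 0 / t) * q / E \<le> (A u - A s) / (k * t)"
  proof -
    have "(k * q) * (v 0 / E) \<le> (k - 2) * (v 0 / E)"
      using v_pos[of 0] by (intro mult_right_mono kq) (auto simp: E_def)
    also note lo
    finally have "k * q * (v 0 / E) / (k * t) \<le> (A u - A s) / (k * t)"
      using k0 t by (intro divide_right_mono) auto
    then show ?thesis using k0 t by (simp add: mult_ac)
  qed
  have "log_mean A c l \<le> ln (E * (v 0 / t) / q)"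
    unfolding m using 1 Aus k0 t by (intro ln_mono) auto
  also have "\<dots> = real N * d + ln (v 0 / t) - ln q"
    using v_pos[of 0] t q by (simp add: ln_div ln_mult E_def)
  finally have a: "log_mean A c l \<le> real N * d + ln (v 0 / t) - ln q" .
  have "ln ((v 0 / t) * q / E) \<le> log_mean A c l"
    unfolding m using 2 v_pos[of 0] t q by (intro ln_mono) (auto simp: E_def)
  moreover have "ln ((v 0 / t) * q / E) = ln (v 0 / t) + ln q - real N * d"
    using v_pos[of 0] t q by (simp add: ln_div ln_mult E_def)
  ultimately have "\<bar>log_mean A c l - ln (v 0 / t)\<bar> \<le> real N * d - ln q" using a by linarith
  then show ?thesis by (simp add: v_def q_def)
qed

text \<open>
  All the intervals to be compared with the one at \<open>(x, y)\<close> lie in the concentric interval of length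
  \<open>3 * y\<close>, and their length is at least a sixth of that.
\<close>
lemma slowly_varying_of_ratios:
  fixes N :: nat
  assumes N: "12 < N" and d: "0 \<le> d"
    and ratio: "\<And>x t. 0 < t \<Longrightarrow> t \<le> 3 * h / real N \<Longrightarrow>
                  \<bar>ln (A (x + t) - A x) - ln (A x - A (x - t))\<bar> \<le> d"
  shows "slowly_varying A h (2 * (real N * d - ln (1 - 12 / real N)))"
  unfolding slowly_varying_def
proof (intro allI impI, elim conjE)
  fix x x' y y' :: real
  assume y: "0 < y" "y \<le> h" "y / 2 \<le> y'" "y' \<le> y" "\<bar>x - x'\<bar> \<le> y"
  define t where "t = 3 * y / real N"
  have t: "0 < t" "t \<le> 3 * h / real N" "real N * t = 3 * y"
    using y N by (auto simp: t_def divide_right_mono)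
  have "\<bar>log_mean A x y - ln ((A (x - 3 * y / 2 + t) - A (x - 3 * y / 2)) / t)\<bar>
          \<le> real N * d - ln (1 - 12 / real N)"
    using y t(3) by (intro log_mean_near_grid_cell N d ratio t) auto
  moreover have "\<bar>log_mean A x' y' - ln ((A (x - 3 * y / 2 + t) - A (x - 3 * y / 2)) / t)\<bar>
          \<le> real N * d - ln (1 - 12 / real N)"
    using y t(3) by (intro log_mean_near_grid_cell N d ratio t) (simp_all add: abs_le_iff)
  ultimately show "\<bar>log_mean A x y - log_mean A x' y'\<bar> \<le> 2 * (real N * d - ln (1 - 12 / real N))"
    unfolding abs_le_iff by (auto simp: algebra_simps)
qed

end

section \<open>The integral of the halving defect over a box\<close>

context
  fixes A :: "real \<Rightarrow> real"
  assumes mono: "strict_mono A" and cont: "continuous_on UNIV A"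
begin

lemma integrable_log_mean_over_scale:
  assumes "a \<le> b" "0 < p"
  shows "(\<lambda>y. integral {a..b} (\<lambda>x. log_mean A x y) / y) integrable_on {p..q}"
    and "continuous_on {0<..} (\<lambda>y. integral {a..b} (\<lambda>x. log_mean A x y))"
    and "continuous_on {0<..} (\<lambda>y. integral {a..b} (\<lambda>x. defect A x y))"
proof -
  have "continuous_on {0<..} (\<lambda>y. integral (cbox a b) (\<lambda>x. log_mean A x y))"
    by (rule integral_continuous_on_param)
       (auto simp: split_beta intro!: continuous_on_log_mean[OF mono cont] continuous_intros)
  then show 1: "continuous_on {0<..} (\<lambda>y. integral {a..b} (\<lambda>x. log_mean A x y))" by simp
  have "continuous_on {0<..} (\<lambda>y. integral (cbox a b) (\<lambda>x. defect A x y))"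
    by (rule integral_continuous_on_param)
       (auto simp: split_beta intro!: continuous_on_defect[OF mono cont] continuous_intros)
  then show "continuous_on {0<..} (\<lambda>y. integral {a..b} (\<lambda>x. defect A x y))" by simp
  have "continuous_on {p..q} (\<lambda>y. integral {a..b} (\<lambda>x. log_mean A x y))"
    using assms by (intro continuous_on_subset[OF 1]) auto
  then show "(\<lambda>y. integral {a..b} (\<lambda>x. log_mean A x y) / y) integrable_on {p..q}"
    using assms by (intro integrable_continuous_real continuous_on_divide continuous_on_id) auto
qed

text \<open>
  The telescoping identity.  The scales between \<open>h / 2\<close> and \<open>h = b - a\<close> contribute \<open>h * ln 2\<close> times the
  logarithmic mean over \<open>{a..b}\<close> up to \<open>d * h\<close>, because \<open>l(x, y)\<close> is within \<open>d\<close> of it for all those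
  \<open>(x, y)\<close>; the boundary terms of all layers together contribute at most \<open>d * h\<close>.
\<close>
lemma truncated_defect_integral:
  assumes sv: "slowly_varying A (b - a) d" and e: "0 < e" "e \<le> b - a"
  shows "\<bar>integral {e..b - a} (\<lambda>y. integral {a..b} (\<lambda>x. defect A x y) / y) -
          ((b - a) * ln 2 * log_mean A ((a + b) / 2) (b - a) -
           integral {e / 2..e} (\<lambda>y. integral {a..b} (\<lambda>x. log_mean A x y) / y))\<bar>
         \<le> 2 * d * (b - a)"
proof -
  define h where "h = b - a"
  define l where "l = log_mean A ((a + b) / 2) h"
  define G where "G = (\<lambda>y. integral {a..b} (\<lambda>x. log_mean A x y))"
  define D where "D = (\<lambda>y. integral {a..b} (\<lambda>x. defect A x y))"
  have h: "0 < h" "e \<le> h" "a \<le> b" "a + h = b" using e by (auto simp: h_def)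
  note sv = sv[folded h_def]
  have d: "0 \<le> d"
    using slowly_varyingD[OF sv, of h h 0 0] h by simp
  have cG: "continuous_on {0<..} G" and cD: "continuous_on {0<..} D"
    unfolding G_def D_def using integrable_log_mean_over_scale(2,3)[of a b 1] h by auto
  have iG: "(\<lambda>y. G y / y) integrable_on {p..q}" if "0 < p" for p q
    unfolding G_def using integrable_log_mean_over_scale(1)[OF _ that] h by auto
  have cD': "continuous_on {e..h} (\<lambda>y. D y / y)"
  proof -
    have "continuous_on {e..h} D"
      using e by (intro continuous_on_subset[OF cD]) auto
    then show ?thesis
      using e by (intro continuous_on_divide continuous_on_id) auto
  qed
  have cG': "continuous_on {e..h} (\<lambda>y. (G y - G (y / 2)) / y)"
  proof -
    have "continuous_on {e..h} G"
      using e by (intro continuous_on_subset[OF cG]) auto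
    moreover have "continuous_on {e..h} (\<lambda>y. G (y / 2))"
      using e by (intro continuous_on_compose2[OF cG] continuous_intros) auto
    ultimately show ?thesis
      using e by (intro continuous_on_divide continuous_on_diff continuous_on_id) auto
  qed
  have "\<bar>integral {e..h} (\<lambda>y. D y / y - (G y - G (y / 2)) / y)\<bar> \<le> d / 4 * (h - e)"
  proof -
    have "\<bar>D y / y - (G y - G (y / 2)) / y\<bar> \<le> d / 4" if "y \<in> {e..h}" for y
    proof -
      have y: "0 < y" "y \<le> h" using that e by auto
      have "\<bar>D y - (G y - G (y / 2))\<bar> / y \<le> (d * y / 4) / y"
        unfolding D_def G_def using integral_defect_layer[OF mono cont sv y h(3)] y
        by (intro divide_right_mono) auto
      then show ?thesis using y by (simp add: abs_divide flip: diff_divide_distrib)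
    qed
    then show ?thesis
      using integral_bound[OF h(2) continuous_on_diff[OF cD' cG'], of "d / 4"] by simp
  qed
  moreover have "d / 4 * (h - e) \<le> d * h"
    using d h e by (simp add: algebra_simps)
  moreover have "integral {e..h} (\<lambda>y. D y / y - (G y - G (y / 2)) / y)
     = integral {e..h} (\<lambda>y. D y / y) - (integral {h / 2..h} (\<lambda>y. G y / y) - integral {e / 2..e} (\<lambda>y. G y / y))"
    using integral_dilation_difference[OF cG e(1) h(2)] cD' cG'
    by (simp add: Henstock_Kurzweil_Integration.integral_diff integrable_continuous_real)
  moreover have "\<bar>integral {h / 2..h} (\<lambda>y. G y / y) - h * ln 2 * l\<bar> \<le> d * h"
  proof -
    have b: "norm (G y / y - h * l / y) \<le> 2 * d" if "y \<in> {h / 2..h}" for y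
    proof -
      have y: "0 < y" "y \<le> h" "h \<le> 2 * y" using that h by auto
      have c: "continuous_on {a..b} (\<lambda>x. log_mean A x y - l)"
        using y by (intro continuous_intros continuous_on_log_mean[OF mono cont]) auto
      have "G y - h * l = integral {a..b} (\<lambda>x. log_mean A x y - l)"
        unfolding G_def using h y
        by (subst Henstock_Kurzweil_Integration.integral_diff)
           (auto intro!: integrable_continuous_real continuous_on_log_mean[OF mono cont] continuous_intros simp: h_def)
      also have "\<bar>\<dots>\<bar> \<le> d * (b - a)"
      proof -
        have "\<bar>log_mean A x y - l\<bar> \<le> d" if "x \<in> {a..b}" for x
        proof -
          have "(a + b) / 2 - x \<le> h" "x - (a + b) / 2 \<le> h"
            using that h by (auto simp: field_simps)
          then have "\<bar>(a + b) / 2 - x\<bar> \<le> h" unfolding abs_le_iff by simp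
          then have "\<bar>l - log_mean A x y\<bar> \<le> d"
            unfolding l_def using y h by (intro slowly_varyingD[OF sv]) auto
          then show ?thesis by (simp add: abs_minus_commute)
        qed
        then show ?thesis
          using integral_bound[OF h(3) c, of d] by simp
      qed
      finally have "\<bar>G y - h * l\<bar> \<le> d * (2 * y)"
        using mult_left_mono[OF y(3) d] by (simp add: h_def)
      then show ?thesis using y by (simp add: field_simps abs_divide flip: diff_divide_distrib)
    qed
    have l1: "((\<lambda>y. h * l / y) has_integral h * l * ln 2) {h / 2..h}"
      using has_integral_mult_right[OF integral_inverse_half[OF h(1)], of "h * l"] by simp
    have "norm (integral {h / 2..h} (\<lambda>y. G y / y) - h * l * ln 2) \<le> 2 * d * measure lborel (cbox (h / 2) h)"
      using has_integral_diff[OF integrable_integral[OF iG[of "h/2" h]] l1] h d b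
      by (intro has_integral_bound[where f="\<lambda>y. G y / y - h * l / y"]) auto
    then show ?thesis using h by (simp add: mult_ac)
  qed
  ultimately have "\<bar>integral {e..h} (\<lambda>y. D y / y) - (h * ln 2 * l - integral {e / 2..e} (\<lambda>y. G y / y))\<bar>
      \<le> d * h + d * h"
    unfolding abs_le_iff by linarith
  then show ?thesis by (simp add: D_def G_def h_def l_def)
qed

lemma nn_integral_defect_box:
  assumes e: "0 < e" and ab: "a \<le> b"
  shows "(\<integral>\<^sup>+z\<in>{a..b} \<times> {e..h}. ennreal (case z of (x, y) \<Rightarrow> defect A x y / y) \<partial>lebesgue)
       = ennreal (integral {e..h} (\<lambda>y. integral {a..b} (\<lambda>x. defect A x y) / y))"
proof -
  let ?f = "\<lambda>z. case z of (x, y) \<Rightarrow> defect A x y / y"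
  have c: "continuous_on (cbox (a, e) (b, h)) ?f"
    unfolding split_beta using e
    by (intro continuous_intros continuous_on_defect[OF mono cont]) (auto simp: cbox_Pair_eq)
  have "integral (cbox (a, e) (b, h)) ?f = integral (cbox a b) (\<lambda>x. integral (cbox e h) (\<lambda>y. defect A x y / y))"
    using integral_prod_continuous[OF c] by simp
  also have "\<dots> = integral (cbox e h) (\<lambda>y. integral (cbox a b) (\<lambda>x. defect A x y / y))"
    by (rule integral_swap_continuous[OF c])
  finally have i: "integral (cbox (a, e) (b, h)) ?f = integral {e..h} (\<lambda>y. integral {a..b} (\<lambda>x. defect A x y) / y)"
    by simp
  have "(?f has_integral integral (cbox (a, e) (b, h)) ?f) (cbox (a, e) (b, h))"
    by (intro integrable_integral integrable_continuous c)
  then have "(\<integral>\<^sup>+z\<in>cbox (a, e) (b, h). ennreal (?f z) \<partial>lborel) = ennreal (integral (cbox (a, e) (b, h)) ?f)"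
    using e by (intro nn_integral_has_integral_lebesgue')
      (auto simp: cbox_Pair_eq intro!: divide_nonneg_pos defect_nonneg[OF mono cont])
  then show ?thesis
    unfolding i by (simp add: nn_integral_completion cbox_Pair_eq)
qed

lemma nn_integral_defect_le:
  assumes ab: "a < b" and le: "\<And>e. 0 < e \<Longrightarrow> e \<le> h \<Longrightarrow>
     integral {e..h} (\<lambda>y. integral {a..b} (\<lambda>x. defect A x y) / y) \<le> M"
    and h: "0 < h"
  shows "(\<integral>\<^sup>+z\<in>{a..b} \<times> {0<..<h}. ennreal (case z of (x, y) \<Rightarrow> defect A x y / y) \<partial>lebesgue) \<le> ennreal M"
proof -
  let ?f = "\<lambda>z. case z of (x, y) \<Rightarrow> defect A x y / y"
  define S where "S = (\<lambda>n::nat. {a..b} \<times> {h / real (Suc n)..h})"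
  have "(\<integral>\<^sup>+z\<in>{a..b} \<times> {0<..<h}. ennreal (?f z) \<partial>lebesgue)
      \<le> (\<integral>\<^sup>+z. (SUP n. ennreal (?f z) * indicator (S n) z) \<partial>lebesgue)"
  proof (intro nn_integral_mono)
    fix z :: "real \<times> real"
    show "ennreal (?f z) * indicator ({a..b} \<times> {0<..<h}) z \<le> (SUP n. ennreal (?f z) * indicator (S n) z)"
    proof (cases "z \<in> {a..b} \<times> {0<..<h}")
      case True
      then obtain n where "h / snd z < real (Suc n)"
        by (meson less_trans lessI of_nat_less_iff reals_Archimedean2)
      with True have "z \<in> S n" by (auto simp: S_def field_simps)
      then show ?thesis using True by (intro SUP_upper2[of n]) auto
    qed simp
  qed
  also have "\<dots> = (SUP n. \<integral>\<^sup>+z\<in>S n. ennreal (?f z) \<partial>lebesgue)"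
  proof (rule nn_integral_monotone_convergence_SUP)
    have "S m \<subseteq> S n" if "m \<le> n" for m n
    proof -
      have "h / real (Suc n) \<le> h / real (Suc m)"
        using that h by (intro divide_left_mono) auto
      then show ?thesis by (auto simp: S_def)
    qed
    then show "incseq (\<lambda>n z. ennreal (?f z) * indicator (S n) z)"
      by (auto simp: incseq_def le_fun_def indicator_def)
  next
    fix n
    have "S n = cbox (a, h / real (Suc n)) (b, h)" by (simp add: S_def cbox_Pair_eq)
    then have S: "S n \<in> sets lebesgue" by simp
    have "0 < h / real (Suc n)" using h by simp
    then have "0 < snd z" if "z \<in> S n" for z
      using that unfolding S_def mem_Times_iff by (meson atLeastAtMost_iff less_le_trans)
    then have "continuous_on (S n) ?f"
      unfolding split_beta using mono cont by (intro continuous_intros) (fastforce dest: less_imp_neq)+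
    from continuous_imp_measurable_on_sets_lebesgue[OF this S]
    have "(\<lambda>z. if z \<in> S n then ?f z else 0) \<in> borel_measurable lebesgue"
      by (metis (no_types) S borel_measurable_if)
    then have "(\<lambda>z. ennreal (if z \<in> S n then ?f z else 0)) \<in> borel_measurable lebesgue"
      by measurable
    also have "(\<lambda>z. ennreal (if z \<in> S n then ?f z else 0)) = (\<lambda>z. ennreal (?f z) * indicator (S n) z)"
      by (auto simp: fun_eq_iff)
    finally show "(\<lambda>z. ennreal (?f z) * indicator (S n) z) \<in> borel_measurable lebesgue" .
  qed
  also have "\<dots> \<le> ennreal M"
  proof (rule SUP_least)
    fix n
    have n: "0 < h / real (Suc n)" "h / real (Suc n) \<le> h"
      using h by (auto simp: divide_le_eq)
    show "(\<integral>\<^sup>+z\<in>S n. ennreal (?f z) \<partial>lebesgue) \<le> ennreal M"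
      unfolding S_def using nn_integral_defect_box[OF n(1), of a b h] ab le[OF n]
      by (simp add: ennreal_leI del: of_nat_Suc)
  qed
  finally show ?thesis .
qed

lemma integral_defect_le_nn_integral:
  assumes ab: "a \<le> b" and e: "0 < e"
  shows "ennreal (integral {e..h} (\<lambda>y. integral {a..b} (\<lambda>x. defect A x y) / y))
       \<le> (\<integral>\<^sup>+z\<in>{a..b} \<times> {0<..<h}. ennreal (case z of (x, y) \<Rightarrow> defect A x y / y) \<partial>lebesgue)"
proof -
  have "{z :: real \<times> real. z \<bullet> (0, 1) = h} \<in> null_sets lebesgue"
    using negligible_standard_hyperplane[of "(0::real, 1::real)" h]
    by (simp add: negligible_iff_null_sets Basis_prod_def)
  then have "AE z :: real \<times> real in lebesgue. snd z \<noteq> h"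
    by (intro AE_I'[of "{z. z \<bullet> (0, 1) = h}"]) auto
  then show ?thesis
    unfolding nn_integral_defect_box[OF e ab, symmetric]
    using e by (intro nn_integral_mono_AE) (auto elim!: eventually_mono simp: indicator_def)
qed

end

section \<open>Small scales\<close>

text \<open>
  Integrating the difference quotient in \<open>x\<close> turns it into two symmetric difference quotients of
  a second primitive, one at each endpoint.
\<close>
lemma integral_symmetric_quotient_tendsto:
  fixes U :: "real \<Rightarrow> real"
  assumes U: "continuous_on UNIV U" and ab: "a \<le> b"
  shows "((\<lambda>y. integral {a..b} (\<lambda>x. (U (x + y / 2) - U (x - y / 2)) / y)) \<longlongrightarrow> U b - U a) (at_right 0)"
proof -
  define V where "V = primitive U"
  have V: "integral {p..q} U = V q - V p" if "p \<le> q" for p q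
    unfolding V_def using that U by (intro integral_eq_primitive continuous_imp_locally_integrable)
  have dV: "(V has_real_derivative U x) (at x)" for x
  proof -
    have "((\<lambda>y. integral {x-1..y} U) has_real_derivative U x) (at x within {x-1..x+1})"
      by (rule integral_has_real_derivative) (auto intro: continuous_on_subset[OF U])
    then have "((\<lambda>y. V (x - 1) + integral {x-1..y} U) has_real_derivative U x) (at x within {x-1..x+1})"
      by (auto intro!: derivative_eq_intros)
    then have "(V has_real_derivative U x) (at x within {x-1..x+1})"
      by (rule has_field_derivative_transform_within[where d=1]) (auto simp: V)
    then show ?thesis
      by (simp add: at_within_Icc_at)
  qed
  have i: "(\<lambda>x. U (x + c)) integrable_on {p..q}" for p q c
    by (intro integrable_continuous_real continuous_on_compose2[OF U] continuous_intros) auto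
  have shift: "integral {a..b} (\<lambda>x. U (x + c)) = V (b + c) - V (a + c)" for c
    using V[of "a + c" "b + c"] integral_shift_real_ivl[of "a + c" c "b + c" U] ab by simp
  have "((\<lambda>y. (V (b + y / 2) - V (b - y / 2)) / y - (V (a + y / 2) - V (a - y / 2)) / y) \<longlongrightarrow> U b - U a) (at_right 0)"
    by (intro tendsto_intros has_derivative_symmetric_quotient dV)
  then show ?thesis
  proof (rule Lim_transform_eventually)
    have "(V (b + y / 2) - V (b - y / 2)) / y - (V (a + y / 2) - V (a - y / 2)) / y
        = integral {a..b} (\<lambda>x. (U (x + y / 2) - U (x - y / 2)) / y)" for y
    proof -
      have "integral {a..b} (\<lambda>x. U (x + y / 2) - U (x + - (y / 2))) 
         = (V (b + y / 2) - V (a + y / 2)) - (V (b - y / 2) - V (a - y / 2))"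
        using i[of "y / 2"] i[of "- (y / 2)"] shift[of "y / 2"] shift[of "- (y / 2)"]
        by (subst Henstock_Kurzweil_Integration.integral_diff) auto
      then show ?thesis by (simp flip: diff_divide_distrib)
    qed
    then show "\<forall>\<^sub>F y in at_right 0. (V (b + y / 2) - V (b - y / 2)) / y - (V (a + y / 2) - V (a - y / 2)) / y
        = integral {a..b} (\<lambda>x. (U (x + y / 2) - U (x - y / 2)) / y)" by simp
  qed
qed

context
  fixes A :: "real \<Rightarrow> real"
  assumes mono: "strict_mono A" and cont: "continuous_on UNIV A"
begin

text \<open>
  Upper bound for the full box.  In the application \<open>U\<close> is a primitive of \<open>log w\<close> and the minorant
  is given by Jensen's inequality; it bounds the term at the small scale in the telescoping
  identity from below.
\<close>
lemma nn_integral_defect_le_of_minorant: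
  assumes sv: "slowly_varying A (b - a) d" and ab: "a < b"
    and U: "continuous_on UNIV U"
    and le: "\<And>x y. 0 < y \<Longrightarrow> (U (x + y / 2) - U (x - y / 2)) / y \<le> log_mean A x y"
  shows "(\<integral>\<^sup>+z\<in>{a..b} \<times> {0<..<b - a}. ennreal (case z of (x, y) \<Rightarrow> defect A x y / y) \<partial>lebesgue)
       \<le> ennreal ((b - a) * ln 2 * log_mean A ((a + b) / 2) (b - a) + 2 * d * (b - a) - ln 2 * (U b - U a))"
proof (rule nn_integral_defect_le[OF mono cont ab])
  define h where "h = b - a"
  define G where "G = (\<lambda>y. integral {a..b} (\<lambda>x. log_mean A x y))"
  define T where "T = (\<lambda>e. integral {e..h} (\<lambda>y. integral {a..b} (\<lambda>x. defect A x y) / y))"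
  show "0 < b - a" using ab by simp
  fix e assume e: "0 < e" "e \<le> b - a"
  have T_anti: "T q \<le> T p" if "0 < p" "p \<le> q" for p q
  proof -
    have "continuous_on {p..h} (\<lambda>y. integral {a..b} (\<lambda>x. defect A x y))"
      using that integrable_log_mean_over_scale(3)[OF mono cont, of a b 1] ab
      by (auto elim!: continuous_on_subset)
    then have c: "continuous_on {p..h} (\<lambda>y. integral {a..b} (\<lambda>x. defect A x y) / y)"
      using that by (intro continuous_on_divide continuous_on_id) auto
    have nn: "0 \<le> integral {a..b} (\<lambda>x. defect A x y) / y" if "0 < y" for y
      using that ab
      by (intro divide_nonneg_pos Henstock_Kurzweil_Integration.integral_nonneg integrable_continuous_real
          continuous_on_defect[OF mono cont] continuous_intros defect_nonneg[OF mono cont]) auto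
    show ?thesis
      unfolding T_def using that nn
      by (intro integral_subset_le integrable_continuous_real c continuous_on_subset[OF c]) auto
  qed
  have "T e \<le> h * ln 2 * log_mean A ((a + b) / 2) h + 2 * d * h - ln 2 * (U b - U a) + \<epsilon>" if "0 < \<epsilon>" for \<epsilon>
  proof -
    have "\<forall>\<^sub>F y in at_right 0. U b - U a - \<epsilon> / ln 2 < integral {a..b} (\<lambda>x. (U (x + y / 2) - U (x - y / 2)) / y)"
      using that ab
      by (intro order_tendstoD(1)[OF integral_symmetric_quotient_tendsto[OF U]]) auto
    then obtain r where r: "0 < r" "\<And>y. 0 < y \<Longrightarrow> y < r \<Longrightarrow>
        U b - U a - \<epsilon> / ln 2 < integral {a..b} (\<lambda>x. (U (x + y / 2) - U (x - y / 2)) / y)"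
      unfolding eventually_at_right_field by auto
    define p where "p = min e (r / 2)"
    have p: "0 < p" "p \<le> e" "p < r" using e r by (auto simp: p_def)
    have "ln 2 * (U b - U a - \<epsilon> / ln 2) \<le> integral {p / 2..p} (\<lambda>y. G y / y)"
    proof (rule has_integral_le)
      show "((\<lambda>y. (U b - U a - \<epsilon> / ln 2) * (1 / y)) has_integral ln 2 * (U b - U a - \<epsilon> / ln 2)) {p / 2..p}"
        using has_integral_mult_right[OF integral_inverse_half[OF p(1)], of "U b - U a - \<epsilon> / ln 2"]
        by (simp add: mult.commute)
      show "((\<lambda>y. G y / y) has_integral integral {p / 2..p} (\<lambda>y. G y / y)) {p / 2..p}"
        unfolding G_def using p ab
        by (intro integrable_integral integrable_log_mean_over_scale(1)[OF mono cont]) auto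
      fix y assume "y \<in> {p / 2..p}"
      then have y: "0 < y" "y < r" using p by auto
      have "U b - U a - \<epsilon> / ln 2 \<le> integral {a..b} (\<lambda>x. (U (x + y / 2) - U (x - y / 2)) / y)"
        using r(2)[OF y] by simp
      also have "\<dots> \<le> G y"
        unfolding G_def using le y
        by (intro integral_le integrable_continuous_real continuous_on_log_mean[OF mono cont]
            continuous_on_divide continuous_on_diff continuous_on_compose2[OF U] continuous_intros) auto
      finally show "(U b - U a - \<epsilon> / ln 2) * (1 / y) \<le> G y / y"
        using y by (simp add: divide_right_mono)
    qed
    moreover have "\<bar>T p - (h * ln 2 * log_mean A ((a + b) / 2) h - integral {p / 2..p} (\<lambda>y. G y / y))\<bar> \<le> 2 * d * h"
      unfolding T_def G_def h_def using p e by (intro truncated_defect_integral[OF mono cont sv]) auto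
    moreover have "ln 2 * (U b - U a - \<epsilon> / ln 2) = ln 2 * (U b - U a) - \<epsilon>"
      by (simp add: right_diff_distrib)
    ultimately have "T p \<le> h * ln 2 * log_mean A ((a + b) / 2) h + 2 * d * h - ln 2 * (U b - U a) + \<epsilon>"
      unfolding abs_le_iff by linarith
    with T_anti[OF p(1,2)] show ?thesis by linarith
  qed
  then show "integral {e..b - a} (\<lambda>y. integral {a..b} (\<lambda>x. defect A x y) / y)
    \<le> (b - a) * ln 2 * log_mean A ((a + b) / 2) (b - a) + 2 * d * (b - a) - ln 2 * (U b - U a)"
    unfolding T_def h_def by (rule field_le_epsilon)
qed

text \<open>
  With \<open>V = exp (log_mean A x y - l)\<close> the integrand is \<open>V - 1 - ln V\<close>.  The integral of \<open>V\<close> tends to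
  \<open>b - a\<close> as \<open>y\<close> tends to \<open>0\<close>, and the telescoping identity bounds the integral of \<open>- ln V\<close> on average
  over the scales \<open>y \<in> {e / 2..e}\<close>; hence it is bounded at one of these scales.
\<close>
lemma exists_scale_small_deviation:
  assumes sv: "slowly_varying A (b - a) d" and ab: "a < b" and C: "0 \<le> C"
    and le: "(\<integral>\<^sup>+z\<in>{a..b} \<times> {0<..<b - a}. ennreal (case z of (x, y) \<Rightarrow> defect A x y / y) \<partial>lebesgue) \<le> ennreal C"
    and l: "l = log_mean A ((a + b) / 2) (b - a)" and r: "0 < r" and \<epsilon>: "0 < \<epsilon>"
  obtains y where "0 < y" "y \<le> r"
    "integral {a..b} (\<lambda>x. exp (log_mean A x y - l) - 1 - (log_mean A x y - l))
       \<le> (2 * d * (b - a) + C) / ln 2 + \<epsilon>"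
proof -
  define h where "h = b - a"
  define K where "K = 2 * d * h + C"
  define G where "G = (\<lambda>y. integral {a..b} (\<lambda>x. log_mean A x y))"
  define H where "H = (\<lambda>y. integral {a..b} (\<lambda>x. (A (x + y / 2) - A (x - y / 2)) / y))"
  define \<Psi> where "\<Psi> = (\<lambda>y. integral {a..b} (\<lambda>x. exp (log_mean A x y - l) - 1 - (log_mean A x y - l)))"
  have h: "0 < h" using ab by (simp add: h_def)
  have el: "exp l = (A b - A a) / h"
  proof -
    have "(a + b) / 2 + h / 2 = b" "(a + b) / 2 - h / 2 = a" by (simp_all add: h_def field_simps)
    then show ?thesis unfolding l h_def[symmetric] using exp_log_mean[OF mono cont h] by simp
  qed
  have \<Psi>: "\<Psi> y = (H y / exp l - h) - (G y - h * l)" if y: "0 < y" for y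
  proof -
    have c: "continuous_on {a..b} (\<lambda>x. log_mean A x y)"
      using y by (intro continuous_on_log_mean[OF mono cont] continuous_intros) auto
    note c' = continuous_on_exp[OF c]
    have "\<Psi> y = integral {a..b} (\<lambda>x. (exp (log_mean A x y) / exp l - 1) - (log_mean A x y - l))"
      unfolding \<Psi>_def by (simp add: exp_diff)
    also have "\<dots> = integral {a..b} (\<lambda>x. exp (log_mean A x y)) / exp l - h - (G y - h * l)"
      using c c' ab unfolding G_def
      by (simp add: Henstock_Kurzweil_Integration.integral_diff integrable_continuous_real
          continuous_on_divide continuous_on_diff h_def)
    also have "integral {a..b} (\<lambda>x. exp (log_mean A x y)) = H y"
      unfolding H_def by (simp add: exp_log_mean[OF mono cont y])
    finally show ?thesis .
  qed
  have "((\<lambda>y. H y / exp l) \<longlongrightarrow> (A b - A a) / exp l) (at_right 0)"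
    unfolding H_def using ab by (intro tendsto_intros integral_symmetric_quotient_tendsto cont) auto
  moreover have "(A b - A a) / exp l < h + \<epsilon> / 2"
    using increment_pos[OF mono cont ab] h \<epsilon> by (simp add: el)
  ultimately have "\<forall>\<^sub>F y in at_right 0. H y / exp l < h + \<epsilon> / 2"
    by (rule order_tendstoD(2))
  then obtain p where p: "0 < p" "\<And>y. 0 < y \<Longrightarrow> y < p \<Longrightarrow> H y / exp l < h + \<epsilon> / 2"
    unfolding eventually_at_right_field by auto
  define e where "e = Min {h, r, p / 2}"
  have e: "0 < e" "e \<le> h" "e \<le> r" "e < p" using h r p by (auto simp: e_def)
  have iG: "((\<lambda>y. G y / y) has_integral integral {e / 2..e} (\<lambda>y. G y / y)) {e / 2..e}"
    unfolding G_def using e ab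
    by (intro integrable_integral integrable_log_mean_over_scale(1)[OF mono cont]) auto
  have "\<exists>y\<in>{e / 2..e}. \<Psi> y \<le> K / ln 2 + \<epsilon>"
  proof (rule ccontr)
    assume "\<not> ?thesis"
    then have less: "K / ln 2 + \<epsilon> < \<Psi> y" if "y \<in> {e / 2..e}" for y
      using that not_le by blast
      \<comment> \<open>\<open>c\<close> is the upper bound for \<open>G\<close> that a too large deviation at all these scales would force;
      half of \<open>\<epsilon>\<close> has been spent on the convergence of \<open>H\<close>, the other half gives the contradiction.\<close>
    define c where "c = h * l - K / ln 2 - \<epsilon> / 2"
    have "integral {e / 2..e} (\<lambda>y. G y / y) \<le> c * ln 2"
    proof (rule has_integral_le[OF iG])
      show "((\<lambda>y. c * (1 / y)) has_integral c * ln 2) {e / 2..e}"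
        by (intro has_integral_mult_right integral_inverse_half e)
      fix y assume y: "y \<in> {e / 2..e}"
      then have "0 < y" "y < p" using e by auto
      then have "G y \<le> c"
        using less[OF y] p(2)[of y] \<Psi>[of y] by (simp add: c_def)
      then show "G y / y \<le> c * (1 / y)"
        using \<open>0 < y\<close> by (simp add: divide_right_mono)
    qed
    also have "c * ln 2 = h * l * ln 2 - K - \<epsilon> * ln 2 / 2"
      by (simp add: c_def left_diff_distrib)
    also have "\<dots> < h * l * ln 2 - K" using \<epsilon> by simp
    finally have 1: "integral {e / 2..e} (\<lambda>y. G y / y) < h * l * ln 2 - K" .
    define T where "T = integral {e..b - a} (\<lambda>y. integral {a..b} (\<lambda>x. defect A x y) / y)"
    have "\<bar>T - (h * ln 2 * l - integral {e / 2..e} (\<lambda>y. G y / y))\<bar> \<le> 2 * d * h"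
      unfolding T_def G_def h_def l using e
      by (intro truncated_defect_integral[OF mono cont sv]) (auto simp: h_def)
    moreover have "ennreal T \<le> ennreal C"
      unfolding T_def using integral_defect_le_nn_integral[OF mono cont, of a b e "b - a"] ab e le
      by (auto intro: order_trans)
    then have "T \<le> C" using C by simp
    ultimately show False using 1 by (simp add: K_def abs_le_iff mult_ac)
  qed
  then obtain y where "y \<in> {e / 2..e}" "\<Psi> y \<le> K / ln 2 + \<epsilon>" by blast
  with e show ?thesis
    by (intro that[of y]) (auto simp: \<Psi>_def K_def h_def)
qed

text \<open>
  Fatou's lemma along a sequence of scales as above.  Almost everywhere the averages converge to
  \<open>f x\<close>, and the deviation \<open>e\<^sup>g - 1 - g\<close> is nonnegative.
\<close>
lemma nn_integral_deviation_le:
  assumes sv: "slowly_varying A (b - a) d" and ab: "a < b" and C: "0 \<le> C"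
    and le: "(\<integral>\<^sup>+z\<in>{a..b} \<times> {0<..<b - a}. ennreal (case z of (x, y) \<Rightarrow> defect A x y / y) \<partial>lebesgue) \<le> ennreal C"
    and l: "l = log_mean A ((a + b) / 2) (b - a)"
    and f: "AE x in lebesgue. (A has_real_derivative f x) (at x)" "AE x in lebesgue. 0 < f x"
  shows "(\<integral>\<^sup>+x\<in>{a..b}. ennreal (exp (ln (f x) - l) - 1 - (ln (f x) - l)) \<partial>lebesgue)
           \<le> ennreal ((2 * d * (b - a) + C) / ln 2)"
proof -
  define K where "K = (2 * d * (b - a) + C) / ln 2"
  define g where "g = (\<lambda>y x. exp (log_mean A x y - l) - 1 - (log_mean A x y - l))"
  have g_nonneg: "0 \<le> g y x" for y x
    unfolding g_def using exp_ge_add_one_self[of "log_mean A x y - l"] by linarith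
  have "\<exists>y>0. y \<le> inverse (real (Suc n)) \<and> integral {a..b} (g y) \<le> K + inverse (real (Suc n))" for n
  proof -
    have "0 < inverse (real (Suc n))" by simp
    from exists_scale_small_deviation[OF sv ab C le l this this] show ?thesis
      unfolding g_def K_def by blast
  qed
  then obtain y where y: "\<And>n. 0 < y n" "\<And>n. y n \<le> inverse (real (Suc n))"
      "\<And>n. integral {a..b} (g (y n)) \<le> K + inverse (real (Suc n))"
    by metis
  have y0: "y \<longlonglongrightarrow> 0"
    by (rule tendsto_sandwich[OF _ _ tendsto_const LIMSEQ_inverse_real_of_nat])
       (use y(1,2) in \<open>auto intro!: always_eventually less_imp_le\<close>)
  then have yr: "filterlim y (at_right 0) sequentially"
    using y(1) by (auto simp: filterlim_at less_imp_neq[THEN not_sym])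
  have cg: "continuous_on {a..b} (g (y n))" for n
    unfolding g_def using y(1)[of n]
    by (intro continuous_intros continuous_on_log_mean[OF mono cont]) auto
  have mg: "(\<lambda>x. ennreal (g (y n) x) * indicator {a..b} x) \<in> borel_measurable lebesgue" for n
  proof -
    have "g (y n) \<in> borel_measurable (lebesgue_on {a..b})"
      by (intro continuous_imp_measurable_on_sets_lebesgue cg) auto
    then have "(\<lambda>x. if x \<in> {a..b} then g (y n) x else 0) \<in> borel_measurable lebesgue"
      by (subst borel_measurable_if) auto
    then have "(\<lambda>x. ennreal (if x \<in> {a..b} then g (y n) x else 0)) \<in> borel_measurable lebesgue"
      by measurable
    also have "(\<lambda>x. ennreal (if x \<in> {a..b} then g (y n) x else 0)) = (\<lambda>x. ennreal (g (y n) x) * indicator {a..b} x)"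
      by (auto simp: fun_eq_iff)
    finally show ?thesis .
  qed
  have ig: "(\<integral>\<^sup>+x\<in>{a..b}. ennreal (g (y n) x) \<partial>lebesgue) = ennreal (integral {a..b} (g (y n)))" for n
    using nn_integral_has_integral_lebesgue'[OF g_nonneg integrable_integral[OF integrable_continuous_real[OF cg]]]
    by (simp add: nn_integral_completion)
  have "AE x in lebesgue. (\<lambda>n. ennreal (g (y n) x) * indicator {a..b} x)
          \<longlonglongrightarrow> ennreal (exp (ln (f x) - l) - 1 - (ln (f x) - l)) * indicator {a..b} x"
    using f
  proof eventually_elim
    case (elim x)
    have "(\<lambda>n. (A (x + y n / 2) - A (x - y n / 2)) / y n) \<longlonglongrightarrow> f x"
      by (rule filterlim_compose[OF has_derivative_symmetric_quotient[OF elim(1)] yr])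
    then have "(\<lambda>n. log_mean A x (y n)) \<longlonglongrightarrow> ln (f x)"
      unfolding log_mean_def using elim(2) by (intro tendsto_ln) auto
    then have "(\<lambda>n. g (y n) x) \<longlonglongrightarrow> exp (ln (f x) - l) - 1 - (ln (f x) - l)"
      unfolding g_def by (intro tendsto_intros)
    then have "(\<lambda>n. ennreal (g (y n) x)) \<longlonglongrightarrow> ennreal (exp (ln (f x) - l) - 1 - (ln (f x) - l))"
      by (rule tendsto_ennrealI)
    then show ?case by (cases "x \<in> {a..b}") auto
  qed
  then have "AE x in lebesgue. ennreal (exp (ln (f x) - l) - 1 - (ln (f x) - l)) * indicator {a..b} x
        = liminf (\<lambda>n. ennreal (g (y n) x) * indicator {a..b} x)"
    by eventually_elim (simp add: lim_imp_Liminf)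
  then have "(\<integral>\<^sup>+x\<in>{a..b}. ennreal (exp (ln (f x) - l) - 1 - (ln (f x) - l)) \<partial>lebesgue)
      = (\<integral>\<^sup>+x. liminf (\<lambda>n. ennreal (g (y n) x) * indicator {a..b} x) \<partial>lebesgue)"
    by (rule nn_integral_cong_AE)
  also have "\<dots> \<le> liminf (\<lambda>n. \<integral>\<^sup>+x\<in>{a..b}. ennreal (g (y n) x) \<partial>lebesgue)"
    by (intro nn_integral_liminf mg)
  also have "\<dots> \<le> liminf (\<lambda>n. ennreal (K + inverse (real (Suc n))))"
    by (intro Liminf_mono always_eventually allI) (simp add: ig ennreal_leI y(3) del: of_nat_Suc)
  also have "\<dots> = ennreal K"
  proof (rule lim_imp_Liminf)
    have "(\<lambda>n. K + inverse (real (Suc n))) \<longlonglongrightarrow> K + 0"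
      by (intro tendsto_intros LIMSEQ_inverse_real_of_nat)
    then show "(\<lambda>n. ennreal (K + inverse (real (Suc n)))) \<longlonglongrightarrow> ennreal K"
      by (intro tendsto_ennrealI) simp
  qed simp
  finally show ?thesis by (simp add: K_def)
qed

end

section \<open>Mean oscillation and exponential deviation\<close>

text \<open>
  The convex function \<open>exp g - 1 - g\<close> lies above its tangents at \<open>s\<close> and \<open>- s\<close>, whose slopes
  \<open>exp s - 1 \<ge> s\<close> and \<open>exp (- s) - 1 \<le> - s / 2\<close> make it dominate \<open>s / 2 * (\<bar>g\<bar> - s)\<close>.
\<close>
lemma abs_le_exp_deviation:
  fixes g s :: real
  assumes s: "0 < s" "s \<le> 1"
  shows "\<bar>g\<bar> \<le> s + 2 / s * (exp g - 1 - g)"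
proof -
  define \<phi> where "\<phi> = exp g - 1 - g"
  have \<phi>: "0 \<le> \<phi>" unfolding \<phi>_def using exp_ge_add_one_self[of g] by linarith
  have "s * (\<bar>g\<bar> - s) \<le> 2 * \<phi>"
  proof -
    consider "\<bar>g\<bar> \<le> s" | "s < g" | "s < - g" by linarith
    then show ?thesis
    proof cases
      case 1
      then have "s * (\<bar>g\<bar> - s) \<le> 0" using s by (intro mult_nonneg_nonpos) auto
      with \<phi> show ?thesis by linarith
    next
      case 2
      have "(1 + s) * (1 + (g - s)) \<le> exp s * exp (g - s)"
        using 2 s by (intro mult_mono exp_ge_add_one_self) auto
      also have "\<dots> = exp g" by (simp flip: exp_add)
      finally have "s * (g - s) \<le> \<phi>" by (simp add: \<phi>_def algebra_simps)
      with \<phi> 2 s show ?thesis by simp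
    next
      case 3
      define r where "r = - g - s"
      have r: "0 < r" "g = - s - r" using 3 by (auto simp: r_def)
      have es: "exp (- s) \<le> 1 - s / 2"
      proof -
        have "exp (- s) \<le> 1 / (1 + s)"
          using exp_ge_add_one_self[of s] s by (simp add: exp_minus field_simps)
        also have "\<dots> \<le> 1 - s / 2"
          using s mult_left_mono[of s 1 s] by (simp add: field_simps)
        finally show ?thesis .
      qed
      have "exp (- s) * (1 - r) \<le> exp (- s) * exp (- r)"
        using exp_ge_add_one_self[of "- r"] by (intro mult_left_mono) auto
      also have "\<dots> = exp g" by (simp add: r flip: exp_add)
      finally have "exp (- s) - exp (- s) * r - 1 + s + r \<le> \<phi>" by (simp add: \<phi>_def r algebra_simps)
      moreover have "exp (- s) * r \<le> (1 - s / 2) * r"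
        using es r by (intro mult_right_mono) auto
      moreover have "0 \<le> exp (- s) - 1 + s" using exp_ge_add_one_self[of "- s"] by simp
      ultimately have "s / 2 * r \<le> \<phi>" by (simp add: algebra_simps)
      moreover have "\<bar>g\<bar> - s = r" using 3 s by (simp add: r_def)
      ultimately show ?thesis by simp
    qed
  qed
  then have "(s * (\<bar>g\<bar> - s)) / s \<le> (2 * \<phi>) / s"
    using s by (intro divide_right_mono) auto
  then show ?thesis using s by (simp add: \<phi>_def)
qed

text \<open>
  Up to the factor 2 the mean is the best constant in the definition of the oscillation.
\<close>
lemma mean_oscillation_le:
  assumes u: "set_integrable lebesgue {a..b} u" and ab: "a < b"
  shows "mean_oscillation u a b \<le> 2 * mean (\<lambda>x. \<bar>u x - c\<bar>) a b"
proof -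
  define m where "m = mean u a b"
  have [simp]: "set_integrable lebesgue {a..b} (\<lambda>x. k::real)" for k
    by (intro absolutely_integrable_continuous_real) auto
  have k: "(LINT x:{a..b}|lebesgue. k::real) = k * (b - a)" for k
    using ab by (subst set_lebesgue_integral_eq_integral) auto
  have iu: "set_integrable lebesgue {a..b} (\<lambda>x. \<bar>u x - k\<bar>)" for k
    using u by (intro set_integrable_abs set_integral_diff) auto
  have "\<bar>m - c\<bar> * (b - a) = \<bar>LINT x:{a..b}|lebesgue. u x - c\<bar>"
    using ab u by (simp add: set_integral_diff k m_def mean_def field_simps abs_mult flip: abs_mult_pos)
  also have "\<dots> \<le> (LINT x:{a..b}|lebesgue. \<bar>u x - c\<bar>)"
    using set_integral_norm_bound[of lebesgue "{a..b}" "\<lambda>x. u x - c"] u by (simp add: set_integral_diff)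
  finally have mc: "\<bar>m - c\<bar> * (b - a) \<le> (LINT x:{a..b}|lebesgue. \<bar>u x - c\<bar>)" .
  have "(LINT x:{a..b}|lebesgue. \<bar>u x - m\<bar>) \<le> (LINT x:{a..b}|lebesgue. \<bar>u x - c\<bar> + \<bar>m - c\<bar>)"
    using iu by (intro set_integral_mono set_integral_add) auto
  also have "\<dots> = (LINT x:{a..b}|lebesgue. \<bar>u x - c\<bar>) + \<bar>m - c\<bar> * (b - a)"
    using iu by (subst set_integral_add) (auto simp: k)
  finally have "(LINT x:{a..b}|lebesgue. \<bar>u x - m\<bar>) \<le> 2 * (LINT x:{a..b}|lebesgue. \<bar>u x - c\<bar>)"
    using mc by linarith
  then show ?thesis
    unfolding mean_oscillation_def m_def[symmetric]
    unfolding mean_def using ab by (simp add: divide_right_mono)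
qed

text \<open>
  The bound \<open>abs_le_exp_deviation\<close> with \<open>s = 1\<close> gives integrability; a small \<open>s\<close>, followed by a
  much smaller \<open>K\<close>, gives small oscillation.
\<close>
lemma oscillation_of_exp_deviation:
  assumes u: "u \<in> borel_measurable lebesgue" and ab: "a < b" and K: "0 \<le> K"
    and le: "(\<integral>\<^sup>+x\<in>{a..b}. ennreal (exp (u x - l) - 1 - (u x - l)) \<partial>lebesgue) \<le> ennreal K"
  shows "set_integrable lebesgue {a..b} u"
    and "0 < s \<Longrightarrow> s \<le> 1 \<Longrightarrow> mean_oscillation u a b \<le> 2 * (s + 2 / s * (K / (b - a)))"
proof -
  define \<phi> where "\<phi> = (\<lambda>x. exp (u x - l) - 1 - (u x - l))"
  have \<phi>_nonneg: "0 \<le> \<phi> x" for x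
    unfolding \<phi>_def using exp_ge_add_one_self[of "u x - l"] by linarith
  have le': "(\<integral>\<^sup>+x\<in>{a..b}. ennreal (\<phi> x) \<partial>lebesgue) \<le> ennreal K"
    unfolding \<phi>_def by (rule le)
  have [measurable]: "u \<in> borel_measurable lebesgue" "\<phi> \<in> borel_measurable lebesgue"
    unfolding \<phi>_def using u by measurable
  have [measurable]: "{a..b} \<in> sets lebesgue" by simp
  have nn: "(\<integral>\<^sup>+x. ennreal (indicator {a..b} x *\<^sub>R \<phi> x) \<partial>lebesgue)
      = (\<integral>\<^sup>+x\<in>{a..b}. ennreal (\<phi> x) \<partial>lebesgue)"
    by (intro nn_integral_cong) (auto simp: indicator_def)
  have i\<phi>: "set_integrable lebesgue {a..b} \<phi>"
    unfolding set_integrable_def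
  proof (rule integrableI_nonneg)
    show "AE x in lebesgue. 0 \<le> indicat_real {a..b} x *\<^sub>R \<phi> x"
      using \<phi>_nonneg by simp
    show "(\<integral>\<^sup>+x. ennreal (indicator {a..b} x *\<^sub>R \<phi> x) \<partial>lebesgue) < \<infinity>"
      unfolding nn using le' by (simp add: order_le_less_trans[OF _ ennreal_less_top])
  qed measurable
  have K\<phi>: "(LINT x:{a..b}|lebesgue. \<phi> x) \<le> K"
  proof -
    have "ennreal (LINT x:{a..b}|lebesgue. \<phi> x) \<le> ennreal K"
      using nn_integral_eq_integral[OF i\<phi>[unfolded set_integrable_def]] \<phi>_nonneg le' nn
      by (simp add: set_lebesgue_integral_def)
    then show ?thesis using K by simp
  qed
  have [simp]: "set_integrable lebesgue {a..b} (\<lambda>x. k::real)" for k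
    by (intro absolutely_integrable_continuous_real) auto
  have "set_integrable lebesgue {a..b} (\<lambda>x. u x - l)"
  proof (rule set_integrable_bound)
    show "set_integrable lebesgue {a..b} (\<lambda>x. 1 + 2 * \<phi> x)"
      using i\<phi> by (intro set_integral_add set_integrable_mult_right) auto
    show "set_borel_measurable lebesgue {a..b} (\<lambda>x. u x - l)"
      unfolding set_borel_measurable_def by measurable
    show "AE x in lebesgue. x \<in> {a..b} \<longrightarrow> norm (u x - l) \<le> norm (1 + 2 * \<phi> x)"
    proof (intro AE_I2 impI)
      fix x
      show "norm (u x - l) \<le> norm (1 + 2 * \<phi> x)"
        using abs_le_exp_deviation[of 1 "u x - l"] \<phi>_nonneg[of x] by (simp add: \<phi>_def)
    qed
  qed
  then have "set_integrable lebesgue {a..b} (\<lambda>x. (u x - l) + l)"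
    by (intro set_integral_add) auto
  then show iu: "set_integrable lebesgue {a..b} u" by simp
  assume s: "0 < s" "s \<le> 1"
  have "\<bar>u x - l\<bar> \<le> s + 2 / s * \<phi> x" for x
    unfolding \<phi>_def by (rule abs_le_exp_deviation[OF s])
  then have "(LINT x:{a..b}|lebesgue. \<bar>u x - l\<bar>) \<le> (LINT x:{a..b}|lebesgue. s + 2 / s * \<phi> x)"
    using iu i\<phi>
    by (intro set_integral_mono set_integral_add set_integrable_abs set_integral_diff set_integrable_mult_right)
       auto
  also have "\<dots> = s * (b - a) + 2 / s * (LINT x:{a..b}|lebesgue. \<phi> x)"
    using i\<phi> ab set_lebesgue_integral_eq_integral(2)[of "{a..b}" "\<lambda>x. s"]
    by (subst set_integral_add) auto
  also have "\<dots> \<le> s * (b - a) + 2 / s * K"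
    using K\<phi> s by (intro add_left_mono mult_left_mono) auto
  finally have "mean (\<lambda>x. \<bar>u x - l\<bar>) a b \<le> (s * (b - a) + 2 / s * K) / (b - a)"
    unfolding mean_def using ab by (intro divide_right_mono) auto
  also have "\<dots> = s + 2 / s * (K / (b - a))"
    using ab by (simp add: add_divide_distrib)
  finally have "2 * mean (\<lambda>x. \<bar>u x - l\<bar>) a b \<le> 2 * (s + 2 / s * (K / (b - a)))"
    by (rule mult_left_mono) simp
  with mean_oscillation_le[OF iu ab, of l]
  show "mean_oscillation u a b \<le> 2 * (s + 2 / s * (K / (b - a)))"
    by (rule order_trans)
qed

section \<open>Masses and positivity of weights\<close>

lemma weightD:
  assumes "weight w"
  shows "w \<in> borel_measurable lebesgue" "\<And>x. 0 \<le> w x" "locally_integrable w"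
  using assms by (auto simp: weight_def)

lemma A_infinity_weightD: "A_infinity_weight w \<Longrightarrow> weight w"
  by (simp add: A_infinity_weight_def)

lemma set_integrable_Icc_subset:
  assumes "locally_integrable u" "E \<in> sets lebesgue" "E \<subseteq> {a..b}"
  shows "set_integrable lebesgue E u"
  using locally_integrableD(1)[OF assms(1), of a b] assms(2,3) by (rule set_integrable_subset)

lemma wmass_interval:
  assumes "locally_integrable w" "x \<le> y"
  shows "wmass w {x..y} = primitive w y - primitive w x"
    and "wmass w {x<..<y} = primitive w y - primitive w x"
proof -
  show "wmass w {x..y} = primitive w y - primitive w x"
    unfolding wmass_def using assms
    by (simp add: set_lebesgue_integral_eq_integral locally_integrableD integral_eq_primitive)
  have "set_integrable lebesgue {x<..<y} w"
    by (rule set_integrable_Icc_subset[OF assms(1), of _ x y]) auto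
  then show "wmass w {x<..<y} = primitive w y - primitive w x"
    unfolding wmass_def using assms
    using integral_open_interval_real[of x y w]
    by (simp add: set_lebesgue_integral_eq_integral integral_eq_primitive)
qed

lemma mono_primitive:
  assumes "weight w"
  shows "mono (primitive w)"
proof (rule monoI)
  fix x y :: real assume "x \<le> y"
  then have "0 \<le> primitive w y - primitive w x"
  proof -
    have "0 \<le> wmass w {x..y}"
      unfolding wmass_def set_lebesgue_integral_def using weightD(2)[OF assms]
      by (intro Bochner_Integration.integral_nonneg) auto
    then show ?thesis
      using wmass_interval(1)[OF weightD(3)[OF assms] \<open>x \<le> y\<close>] by simp
  qed
  then show "primitive w x \<le> primitive w y" by simp
qed

lemma wmass_Un_compl:
  assumes "locally_integrable w" "E \<in> sets lebesgue" "E \<subseteq> {a..b}"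
  shows "wmass w {a..b} = wmass w E + wmass w ({a..b} - E)"
proof -
  have "E \<union> ({a..b} - E) = {a..b}" using assms(3) by auto
  moreover have "(LINT x:E \<union> ({a..b} - E)|lebesgue. w x)
     = (LINT x:E|lebesgue. w x) + (LINT x:{a..b} - E|lebesgue. w x)"
    using assms by (intro set_integral_Un set_integrable_Icc_subset[of w _ a b]) auto
  ultimately show ?thesis unfolding wmass_def by (simp only:)
qed

lemma A_infinityE:
  assumes "A_infinity_weight w" "0 < \<epsilon>"
  obtains \<delta> where "0 < \<delta>"
    "\<And>a b E. a < b \<Longrightarrow> E \<in> sets lebesgue \<Longrightarrow> E \<subseteq> {a..b} \<Longrightarrow> measure lebesgue E \<le> \<delta> * (b - a) \<Longrightarrow>
       wmass w E \<le> \<epsilon> * wmass w {a..b}"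
proof -
  note conjunct2[OF assms(1)[unfolded A_infinity_weight_def]]
  from mp[OF spec[OF this] assms(2)] obtain \<delta> where "0 < \<delta> \<and> (\<forall>a b E. a < b \<and> E \<in> sets lebesgue \<and> E \<subseteq> {a..b} \<and>
       measure lebesgue E \<le> \<delta> * (b - a) \<longrightarrow> wmass w E \<le> \<epsilon> * wmass w {a..b})" ..
  then have "0 < \<delta>" and \<delta>: "\<And>a b E. a < b \<and> E \<in> sets lebesgue \<and> E \<subseteq> {a..b} \<and>
       measure lebesgue E \<le> \<delta> * (b - a) \<longrightarrow> wmass w E \<le> \<epsilon> * wmass w {a..b}" by blast+
  show thesis
  proof (rule that[OF \<open>0 < \<delta>\<close>])
    fix a b :: real and E
    assume "a < b" "E \<in> sets lebesgue" "E \<subseteq> {a..b}" "measure lebesgue E \<le> \<delta> * (b - a)"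
    with \<delta>[of a b E] show "wmass w E \<le> \<epsilon> * wmass w {a..b}" by blast
  qed
qed

text \<open>
  An interval \<open>{p..q}\<close> of mass zero and length at least \<open>b - a\<close> can be enlarged: an adjacent interval of length
  \<open>\<delta> * (b - a)\<close> is a small proportion of their union and carries all of its mass, so that by the
  \<open>A\<^sub>\<infinity>\<close> condition the union is null too.  Repeating this exhausts the line.
\<close>
lemma A_infinity_primitive_strict_mono:
  assumes A: "A_infinity_weight w"
  shows "strict_mono (primitive w)"
proof (rule ccontr)
  note W = weightD[OF A_infinity_weightD[OF A]]
  define F where "F = primitive w"
  have mono: "x \<le> y \<Longrightarrow> F x \<le> F y" for x y
    using mono_primitive[OF A_infinity_weightD[OF A]] by (simp add: F_def mono_def)
  obtain \<delta> where \<delta>: "0 < \<delta>" and Ainf: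
    "\<And>a b E. a < b \<Longrightarrow> E \<in> sets lebesgue \<Longrightarrow> E \<subseteq> {a..b} \<Longrightarrow> measure lebesgue E \<le> \<delta> * (b - a) \<Longrightarrow>
       wmass w E \<le> 1 / 2 * wmass w {a..b}"
    using A_infinityE[OF A, of "1/2"] by auto
  assume "\<not> strict_mono (primitive w)"
  then obtain a b where ab: "a < b" "\<not> F a < F b"
    unfolding F_def strict_mono_def by blast
  have eq: "F a = F b" using ab mono[of a b] by simp
  define s where "s = \<delta> * (b - a)"
  have s: "0 < s" using \<delta> ab by (simp add: s_def)
  have const: "F (a - real n * s) = F (b + real n * s)" for n
  proof (induction n)
    case (Suc n)
    define p where "p = a - real n * s"
    define q where "q = b + real n * s"
    have pq: "p < q" "b - a \<le> q - p" "F p = F q"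
      using Suc ab s by (auto simp: p_def q_def intro: less_le_trans add_increasing2)
    have "\<delta> * (b - a) \<le> \<delta> * (q - p + s)"
      using \<delta> pq(2) s by (intro mult_left_mono) linarith+
    moreover have "q + s - p = q - p + s" "q - (p - s) = q - p + s" by simp_all
    ultimately have small: "s \<le> \<delta> * (q + s - p)" "s \<le> \<delta> * (q - (p - s))"
      by (simp_all only: s_def)
    have "wmass w {q..q + s} \<le> 1 / 2 * wmass w {p..q + s}"
      by (rule Ainf) (use pq(1) s small(1) in simp_all)
    then have "F (q + s) = F q"
      using pq s mono[of q "q + s"] wmass_interval(1)[OF W(3)] by (simp add: F_def)
    moreover have "wmass w {p - s..p} \<le> 1 / 2 * wmass w {p - s..q}"
      by (rule Ainf) (use pq(1) s small(2) in simp_all)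
    then have "F (p - s) = F p"
      using pq s mono[of "p - s" p] wmass_interval(1)[OF W(3)] by (simp add: F_def)
    moreover have "p - s = a - real (Suc n) * s" "q + s = b + real (Suc n) * s"
      by (simp_all add: p_def q_def algebra_simps)
    ultimately show ?case using pq(3) by simp
  qed (simp add: eq)
  have "F x = F a" for x
  proof -
    obtain n where "\<bar>x\<bar> + \<bar>a\<bar> + \<bar>b\<bar> < real n * s"
      using reals_Archimedean3[OF s] by blast
    then have "a - real n * s \<le> x" "x \<le> b + real n * s" "a - real n * s \<le> a" "a \<le> b + real n * s"
      using ab by auto
    then show ?thesis
      using mono[of "a - real n * s" x] mono[of x "b + real n * s"] mono[of "a - real n * s" a]
        mono[of a "b + real n * s"] const[of n] by linarith
  qed
  then have "F = (\<lambda>x. F a)" by (rule ext)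
  then obtain c where F: "F = (\<lambda>x. c)" ..
  have "AE x in lebesgue. w x = 0"
    using AE_primitive_has_derivative[OF W(3)]
  proof eventually_elim
    case (elim x)
    then have "((\<lambda>x. c) has_real_derivative w x) (at x)"
      unfolding F_def[symmetric] F .
    from DERIV_unique[OF this DERIV_const] show "w x = 0" .
  qed
  moreover have "\<not> (AE x in lebesgue. w x = 0)"
    using A_infinity_weightD[OF A] unfolding weight_def by (elim conjE)
  ultimately show False by (rule notE[rotated])
qed

text \<open>
  Near a density point of the zero set of \<open>w\<close>, the set where \<open>w\<close> is positive is a small
  proportion of some interval and carries all its mass, against the \<open>A\<^sub>\<infinity>\<close> condition.
\<close>
lemma A_infinity_pos_AE:
  assumes A: "A_infinity_weight w"
  shows "AE x in lebesgue. 0 < w x"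
proof -
  note W = weightD[OF A_infinity_weightD[OF A]]
  define P where "P = {x. 0 < w x}"
  have P: "P \<in> sets lebesgue"
  proof -
    have "w -` {0<..} \<inter> space lebesgue \<in> sets lebesgue"
      by (rule measurable_sets[OF W(1)]) simp
    moreover have "w -` {0<..} \<inter> space lebesgue = P" by (auto simp: P_def)
    ultimately show ?thesis by (simp only:)
  qed
  obtain \<delta> where \<delta>: "0 < \<delta>" and Ainf:
    "\<And>a b E. a < b \<Longrightarrow> E \<in> sets lebesgue \<Longrightarrow> E \<subseteq> {a..b} \<Longrightarrow> measure lebesgue E \<le> \<delta> * (b - a) \<Longrightarrow>
       wmass w E \<le> 1 / 2 * wmass w {a..b}"
    using A_infinityE[OF A, of "1/2"] by auto
  have li: "locally_integrable (indicat_real P)"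
    unfolding locally_integrable_def
  proof (intro allI impI)
    fix C :: "real set" assume C: "compact C"
    have "P \<inter> C \<in> lmeasurable"
      using P C fmeasurableD[OF lmeasurable_compact[OF C]]
      by (intro bounded_set_imp_lmeasurable) (auto intro: bounded_subset compact_imp_bounded)
    then have "integrable lebesgue (indicat_real (P \<inter> C))"
      by (intro integrable_real_indicator) (auto simp: fmeasurable_def)
    moreover have "(\<lambda>x. indicat_real C x *\<^sub>R indicat_real P x) = indicat_real (P \<inter> C)"
      by (auto simp: fun_eq_iff indicator_def)
    ultimately show "indicat_real P absolutely_integrable_on C"
      unfolding set_integrable_def by (simp only:)
  qed
  define B where "B = primitive (indicat_real P)"
  have "AE x in lebesgue. (B has_real_derivative indicat_real P x) (at x)"
    unfolding B_def by (rule AE_primitive_has_derivative[OF li])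
  then show ?thesis
  proof eventually_elim
    case (elim x)
    show "0 < w x"
    proof (rule ccontr)
      assume "\<not> 0 < w x"
      then have "indicat_real P x = 0" by (simp add: P_def)
      with elim have "((\<lambda>h. (B (x + h) - B x) / h) \<longlongrightarrow> 0) (at 0)"
        unfolding DERIV_def by simp
      then have "((\<lambda>h. (B (x + h) - B x) / h) \<longlongrightarrow> 0) (at_right 0)"
        by (rule tendsto_mono[OF at_le, rotated]) simp
      then have "\<forall>\<^sub>F h in at_right 0. (B (x + h) - B x) / h < \<delta>"
        using \<delta> by (rule order_tendstoD(2))
      then obtain h where h: "0 < h" "(B (x + h) - B x) / h < \<delta>"
        unfolding eventually_at_right_field using dense by blast
      have "P \<inter> {x..x+h} \<in> lmeasurable"
        using P by (intro bounded_set_imp_lmeasurable) (auto intro: bounded_subset[OF bounded_closed_interval])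
      then have "measure lebesgue (P \<inter> {x..x+h}) = integral {x..x+h} (indicat_real P)"
        by (subst integral_indicator) (simp_all add: Int_commute)
      also have "\<dots> = B (x + h) - B x"
        unfolding B_def using h by (intro integral_eq_primitive li) auto
      also have "\<dots> \<le> \<delta> * (x + h - x)"
        using h by (simp add: field_simps)
      finally have "wmass w (P \<inter> {x..x+h}) \<le> 1 / 2 * wmass w {x..x+h}"
        using h P by (intro Ainf) auto
      moreover have "wmass w (P \<inter> {x..x+h}) = wmass w {x..x+h}"
        unfolding wmass_def set_lebesgue_integral_def
        by (intro Bochner_Integration.integral_cong refl)
           (use W(2) in \<open>auto simp: indicator_def P_def not_less intro: antisym\<close>)
      moreover have "0 < wmass w {x..x+h}"
        using wmass_interval(1)[OF W(3), of x "x + h"] h A_infinity_primitive_strict_mono[OF A]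
        by (simp add: strict_mono_def)
      ultimately show False by simp
    qed
  qed
qed

section \<open>The Jensen gap\<close>

definition jensen_gap :: "(real \<Rightarrow> real) \<Rightarrow> real \<Rightarrow> real \<Rightarrow> real" where
  "jensen_gap w a b = ln (mean w a b) - mean (\<lambda>x. ln (w x)) a b"

lemma mean_eq_primitive:
  assumes "locally_integrable f" "a \<le> b"
  shows "mean f a b = (primitive f b - primitive f a) / (b - a)"
  using assms by (simp add: mean_def set_lebesgue_integral_eq_integral locally_integrableD integral_eq_primitive)

lemma log_mean_primitive:
  assumes "locally_integrable w" "0 < y"
  shows "log_mean (primitive w) x y = ln (mean w (x - y / 2) (x + y / 2))"
  using assms by (simp add: log_mean_def mean_eq_primitive)

lemma locally_integrable_const: "locally_integrable (\<lambda>x. k::real)"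
  by (intro continuous_imp_locally_integrable continuous_intros)

lemma mean_const: "a < b \<Longrightarrow> mean (\<lambda>x. k) a b = k"
  unfolding mean_def
  by (subst set_lebesgue_integral_eq_integral) (auto intro: locally_integrableD locally_integrable_const)

text \<open>
  Jensen's inequality, from \<open>ln t \<le> t / c - 1 + ln c\<close> with \<open>c\<close> the mean of \<open>w\<close>.
\<close>
lemma jensen_gap_nonneg:
  assumes w: "locally_integrable w" "AE x in lebesgue. 0 < w x" "0 < mean w a b"
    and u: "locally_integrable (\<lambda>x. ln (w x))" and ab: "a < b"
  shows "0 \<le> jensen_gap w a b"
proof -
  define c where "c = mean w a b"
  have c: "0 < c" using w by (simp add: c_def)
  note i = locally_integrableD(1)[OF w(1), of a b] locally_integrableD(1)[OF u, of a b]
    locally_integrableD(1)[OF locally_integrable_const, of a b]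
  have "(LINT x:{a..b}|lebesgue. ln (w x)) \<le> (LINT x:{a..b}|lebesgue. w x / c + (ln c - 1))"
  proof (rule set_integral_mono_AE)
    show "set_integrable lebesgue {a..b} (\<lambda>x. w x / c + (ln c - 1))"
      using i c by (intro set_integral_add set_integrable_divide) auto
    show "AE x \<in> {a..b} in lebesgue. ln (w x) \<le> w x / c + (ln c - 1)"
      using w(2)
    proof eventually_elim
      case (elim x)
      then have "ln (w x / c) \<le> w x / c - 1" using c by (intro ln_le_minus_one) auto
      then show ?case using elim c by (simp add: ln_div)
    qed
  qed (rule i)
  also have "\<dots> = (LINT x:{a..b}|lebesgue. w x) / c + (LINT x:{a..b}|lebesgue. ln c - 1)"
    using i c by (subst set_integral_add) (auto intro!: set_integrable_divide)
  also have "(LINT x:{a..b}|lebesgue. ln c - 1) = (ln c - 1) * (b - a)"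
    using mean_const[OF ab, of "ln c - 1"] ab by (simp add: mean_def field_simps)
  also have "(LINT x:{a..b}|lebesgue. w x) = c * (b - a)"
    using ab by (simp add: c_def mean_def)
  finally have "(LINT x:{a..b}|lebesgue. ln (w x)) \<le> ln c * (b - a)"
    using c by (simp add: left_diff_distrib)
  then have "mean (\<lambda>x. ln (w x)) a b \<le> ln c"
    using ab by (simp add: mean_def pos_divide_le_eq)
  then show ?thesis by (simp add: jensen_gap_def c_def)
qed

lemma A_infinity_mean_pos:
  assumes "A_infinity_weight w" "a < b"
  shows "0 < mean w a b"
  using assms A_infinity_primitive_strict_mono[of w] weightD(3)[OF A_infinity_weightD[OF assms(1)]]
  by (simp add: mean_eq_primitive strict_mono_def)

lemma measure_deviation_le:
  assumes u: "set_integrable lebesgue {a..b} u" and um: "u \<in> borel_measurable lebesgue"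
    and ab: "a < b" and \<tau>: "0 < \<tau>"
  shows "\<tau> * measure lebesgue {x \<in> {a..b}. \<tau> < \<bar>u x - mean u a b\<bar>} \<le> mean_oscillation u a b * (b - a)"
    and "{x \<in> {a..b}. \<tau> < \<bar>u x - mean u a b\<bar>} \<in> lmeasurable"
proof -
  define m where "m = mean u a b"
  define E where "E = {x \<in> {a..b}. \<tau> < \<bar>u x - m\<bar>}"
  have "{x \<in> space lebesgue. \<tau> < \<bar>u x - m\<bar>} \<in> sets lebesgue"
    using um by measurable
  then have "{x. \<tau> < \<bar>u x - m\<bar>} \<inter> {a..b} \<in> sets lebesgue" by auto
  moreover have "{x. \<tau> < \<bar>u x - m\<bar>} \<inter> {a..b} = E" by (auto simp: E_def)
  ultimately have "E \<in> sets lebesgue" by simp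
  then have E: "E \<in> lmeasurable"
    by (rule bounded_set_imp_lmeasurable[rotated]) (auto simp: E_def intro: bounded_subset[OF bounded_closed_interval])
  then show "{x \<in> {a..b}. \<tau> < \<bar>u x - mean u a b\<bar>} \<in> lmeasurable"
    by (simp add: E_def m_def)
  have c: "set_integrable lebesgue {a..b} (\<lambda>x. k::real)" for k
    by (intro locally_integrableD locally_integrable_const)
  have i: "integrable lebesgue (\<lambda>x. indicator {a..b} x *\<^sub>R \<bar>u x - m\<bar>)"
    using set_integrable_abs[OF set_integral_diff(1)[OF u c]] by (simp add: set_integrable_def)
  have "\<tau> * measure lebesgue E = (LINT x|lebesgue. \<tau> * indicator E x)"
    using E by simp
  also have "\<dots> \<le> (LINT x|lebesgue. indicator {a..b} x *\<^sub>R \<bar>u x - m\<bar>)"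
  proof (rule integral_mono)
    show "integrable lebesgue (\<lambda>x. \<tau> * indicator E x)"
      using E by (intro integrable_mult_right integrable_real_indicator) (auto simp: fmeasurable_def)
    show "integrable lebesgue (\<lambda>x. indicator {a..b} x *\<^sub>R \<bar>u x - m\<bar>)" by (rule i)
  qed (auto simp: E_def indicator_def)
  also have "\<dots> = mean_oscillation u a b * (b - a)"
    unfolding mean_oscillation_def m_def[symmetric]
    unfolding mean_def using ab by (simp add: set_lebesgue_integral_def)
  finally show "\<tau> * measure lebesgue {x \<in> {a..b}. \<tau> < \<bar>u x - mean u a b\<bar>} \<le> mean_oscillation u a b * (b - a)"
    by (simp add: E_def m_def)
qed

text \<open>
  By Chebyshev's inequality the set \<open>E\<close> where \<open>ln (w x)\<close> is farther than \<open>\<tau>\<close> from its mean is a proportion of at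
  most \<open>\<delta>\<close> of the interval, so it carries at most the fraction \<open>\<epsilon>\<close> of the mass.  Off \<open>E\<close> the
  weight is at most \<open>exp \<tau>\<close> times the geometric mean.
\<close>
lemma A_infinity_jensen_gap_le:
  assumes A: "A_infinity_weight w" and u: "locally_integrable (\<lambda>x. ln (w x))"
    and \<epsilon>: "0 < \<epsilon>" "\<epsilon> < 1"
  obtains \<delta> where "0 < \<delta>"
    "\<And>a b \<tau>. a < b \<Longrightarrow> 0 < \<tau> \<Longrightarrow> mean_oscillation (\<lambda>x. ln (w x)) a b \<le> \<tau> * \<delta> \<Longrightarrow>
       jensen_gap w a b \<le> \<tau> - ln (1 - \<epsilon>)"
proof -
  note W = weightD[OF A_infinity_weightD[OF A]]
  have um: "(\<lambda>x. ln (w x)) \<in> borel_measurable lebesgue"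
    using W(1) by measurable
  obtain \<delta> where \<delta>: "0 < \<delta>" and Ainf:
    "\<And>a b E. a < b \<Longrightarrow> E \<in> sets lebesgue \<Longrightarrow> E \<subseteq> {a..b} \<Longrightarrow> measure lebesgue E \<le> \<delta> * (b - a) \<Longrightarrow>
       wmass w E \<le> \<epsilon> * wmass w {a..b}"
    using A_infinityE[OF A \<epsilon>(1)] by blast
  have "jensen_gap w a b \<le> \<tau> - ln (1 - \<epsilon>)"
    if ab: "a < b" and \<tau>: "0 < \<tau>" and osc: "mean_oscillation (\<lambda>x. ln (w x)) a b \<le> \<tau> * \<delta>" for a b \<tau>
  proof -
    define m where "m = mean (\<lambda>x. ln (w x)) a b"
    define E where "E = {x \<in> {a..b}. \<tau> < \<bar>ln (w x) - m\<bar>}"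
    have E: "E \<in> lmeasurable" "E \<subseteq> {a..b}"
      unfolding E_def m_def using measure_deviation_le(2)[OF locally_integrableD(1)[OF u] um ab \<tau>] by auto
    have "\<tau> * measure lebesgue E \<le> mean_oscillation (\<lambda>x. ln (w x)) a b * (b - a)"
      unfolding E_def m_def by (rule measure_deviation_le(1)[OF locally_integrableD(1)[OF u] um ab \<tau>])
    also have "\<dots> \<le> \<tau> * \<delta> * (b - a)"
      using osc ab by (intro mult_right_mono) auto
    finally have "\<tau> * measure lebesgue E \<le> \<tau> * (\<delta> * (b - a))"
      by (simp only: mult.assoc)
    then have small: "measure lebesgue E \<le> \<delta> * (b - a)" using \<tau> by simp
    have rest: "wmass w ({a..b} - E) \<le> exp (m + \<tau>) * (b - a)"
    proof -
      have Em: "{a..b} - E \<in> lmeasurable"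
        using E by (intro fmeasurable.Diff) auto
      have "wmass w ({a..b} - E) \<le> (LINT x:{a..b} - E|lebesgue. exp (m + \<tau>))"
        unfolding wmass_def
      proof (rule set_integral_mono_AE)
        show "set_integrable lebesgue ({a..b} - E) w"
          using Em by (intro set_integrable_Icc_subset[OF W(3), of _ a b]) auto
        show "set_integrable lebesgue ({a..b} - E) (\<lambda>x. exp (m + \<tau>))"
          using Em by (intro set_integrable_Icc_subset[OF locally_integrable_const, of _ a b]) auto
        show "AE x \<in> {a..b} - E in lebesgue. w x \<le> exp (m + \<tau>)"
          using A_infinity_pos_AE[OF A]
        proof eventually_elim
          case (elim x)
          show ?case
          proof
            assume "x \<in> {a..b} - E"
            then have "ln (w x) \<le> m + \<tau>" by (auto simp: E_def not_less abs_le_iff)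
            then have "exp (ln (w x)) \<le> exp (m + \<tau>)" by simp
            then show "w x \<le> exp (m + \<tau>)" using elim by simp
          qed
        qed
      qed
      also have "\<dots> = exp (m + \<tau>) * measure lebesgue ({a..b} - E)"
        using Em by (simp add: set_lebesgue_integral_def)
      also have "\<dots> \<le> exp (m + \<tau>) * measure lebesgue {a..b}"
        using Em by (intro mult_left_mono measure_mono_fmeasurable) auto
      finally show ?thesis using ab by simp
    qed
    have "wmass w {a..b} \<le> \<epsilon> * wmass w {a..b} + exp (m + \<tau>) * (b - a)"
      using wmass_Un_compl[OF W(3) _ E(2)] Ainf[OF ab _ E(2) small] rest E(1) by auto
    then have "wmass w {a..b} * (1 - \<epsilon>) \<le> exp (m + \<tau>) * (b - a)"
      by (simp add: algebra_simps)
    then have "mean w a b \<le> exp (m + \<tau>) / (1 - \<epsilon>)"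
      using ab \<epsilon> by (simp add: mean_def wmass_def field_simps)
    then have "ln (mean w a b) \<le> ln (exp (m + \<tau>) / (1 - \<epsilon>))"
      using A_infinity_mean_pos[OF A ab] \<epsilon> by (intro ln_mono) auto
    then show ?thesis
      using \<epsilon> by (simp add: ln_div jensen_gap_def m_def)
  qed
  with \<delta> show thesis using that by blast
qed

lemma mean_subinterval_le:
  assumes u: "locally_integrable u" and pq: "a \<le> p" "p < q" "q \<le> b"
  shows "\<bar>mean u p q - mean u a b\<bar> \<le> (b - a) / (q - p) * mean_oscillation u a b"
proof -
  define m where "m = mean u a b"
  note i = locally_integrableD(1)[OF u] locally_integrableD(1)[OF locally_integrable_const]
  have i': "set_integrable lebesgue {c..d} (\<lambda>x. \<bar>u x - m\<bar>)" for c d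
    by (intro set_integrable_abs set_integral_diff i)
  have "mean u p q - m = mean (\<lambda>x. u x - m) p q"
    using pq i mean_const[OF pq(2), of m] unfolding mean_def
    by (simp add: set_integral_diff diff_divide_distrib)
  then have "\<bar>mean u p q - m\<bar> = \<bar>LINT x:{p..q}|lebesgue. u x - m\<bar> / (q - p)"
    using pq by (simp add: mean_def abs_divide)
  also have "\<dots> \<le> (LINT x:{p..q}|lebesgue. \<bar>u x - m\<bar>) / (q - p)"
    using set_integral_norm_bound[of lebesgue "{p..q}" "\<lambda>x. u x - m"] i pq
    by (intro divide_right_mono) (simp_all add: set_integral_diff)
  also have "\<dots> \<le> (LINT x:{a..b}|lebesgue. \<bar>u x - m\<bar>) / (q - p)"
  proof (rule divide_right_mono)
    show "(LINT x:{p..q}|lebesgue. \<bar>u x - m\<bar>) \<le> (LINT x:{a..b}|lebesgue. \<bar>u x - m\<bar>)"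
      using i' pq unfolding set_lebesgue_integral_def set_integrable_def
      by (intro integral_mono) (auto simp: indicator_def)
  qed (use pq in simp)
  finally show ?thesis
    using pq by (simp add: mean_oscillation_def m_def[symmetric] mean_def[of "\<lambda>x. \<bar>u x - m\<bar>"])
qed

text \<open>
  The logarithmic mean is the mean of \<open>ln (w x)\<close> plus the Jensen gap.  The means over the two intervals
  are compared with the mean over the concentric interval of length \<open>3 * y\<close>, which costs \<open>3 * \<kappa>\<close> and \<open>6 * \<kappa>\<close>;
  the gaps cost \<open>\<kappa>\<close>.
\<close>
lemma slowly_varying_of_jensen_gap:
  assumes A: "A_infinity_weight w" and u: "locally_integrable (\<lambda>x. ln (w x))"
    and gap: "\<And>a b. a < b \<Longrightarrow> b - a \<le> 3 * h \<Longrightarrow> jensen_gap w a b \<le> \<kappa>"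
    and osc: "\<And>a b. a < b \<Longrightarrow> b - a \<le> 3 * h \<Longrightarrow> mean_oscillation (\<lambda>x. ln (w x)) a b \<le> \<kappa>"
  shows "slowly_varying (primitive w) h (10 * \<kappa>)"
  unfolding slowly_varying_def
proof (intro allI impI, elim conjE)
  fix x x' y y' :: real
  assume y: "0 < y" "y \<le> h" "y / 2 \<le> y'" "y' \<le> y" "\<bar>x - x'\<bar> \<le> y"
  note w = weightD(3)[OF A_infinity_weightD[OF A]]
  define a where "a = x - 3 * y / 2"
  define b where "b = x + 3 * y / 2"
  have ab: "a < b" "b - a \<le> 3 * h" "b - a = 3 * y" using y by (auto simp: a_def b_def)
  define m where "m = mean (\<lambda>x. ln (w x)) a b"
  have o: "mean_oscillation (\<lambda>x. ln (w x)) a b \<le> \<kappa>" by (rule osc[OF ab(1,2)])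
  have \<kappa>: "0 \<le> \<kappa>"
    using jensen_gap_nonneg[OF w A_infinity_pos_AE[OF A] A_infinity_mean_pos[OF A ab(1)] u ab(1)] gap[OF ab(1,2)]
    by linarith
  have near: "\<bar>mean (\<lambda>x. ln (w x)) (z - t / 2) (z + t / 2) - m\<bar> \<le> 3 * y / t * \<kappa>"
    if "0 < t" "a \<le> z - t / 2" "z + t / 2 \<le> b" for z t
  proof -
    have "\<bar>mean (\<lambda>x. ln (w x)) (z - t / 2) (z + t / 2) - m\<bar>
        \<le> (b - a) / (z + t / 2 - (z - t / 2)) * mean_oscillation (\<lambda>x. ln (w x)) a b"
      unfolding m_def using that by (intro mean_subinterval_le u) auto
    also have "\<dots> \<le> 3 * y / t * \<kappa>"
      using o that y by (intro mult_mono) (auto simp: ab mean_oscillation_def mean_def set_lebesgue_integral_def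
          intro!: divide_nonneg_pos Bochner_Integration.integral_nonneg)
    finally show ?thesis .
  qed
  have g: "0 \<le> jensen_gap w (z - t / 2) (z + t / 2)" "jensen_gap w (z - t / 2) (z + t / 2) \<le> \<kappa>"
    "log_mean (primitive w) z t = mean (\<lambda>x. ln (w x)) (z - t / 2) (z + t / 2) + jensen_gap w (z - t / 2) (z + t / 2)"
    if "0 < t" "t \<le> y" for z t
  proof -
    show "0 \<le> jensen_gap w (z - t / 2) (z + t / 2)"
      using that by (intro jensen_gap_nonneg w A_infinity_pos_AE A u A_infinity_mean_pos) auto
    show "jensen_gap w (z - t / 2) (z + t / 2) \<le> \<kappa>"
      using that y by (intro gap) auto
    show "log_mean (primitive w) z t = mean (\<lambda>x. ln (w x)) (z - t / 2) (z + t / 2) + jensen_gap w (z - t / 2) (z + t / 2)"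
      by (simp add: jensen_gap_def log_mean_primitive[OF w that(1)])
  qed
  have y': "0 < y'" using y by simp
  have 1: "\<bar>mean (\<lambda>x. ln (w x)) (x - y / 2) (x + y / 2) - m\<bar> \<le> 3 * \<kappa>"
    using near[of y x] y by (simp add: a_def b_def)
  have 2: "\<bar>mean (\<lambda>x. ln (w x)) (x' - y' / 2) (x' + y' / 2) - m\<bar> \<le> 6 * \<kappa>"
  proof -
    have "\<bar>mean (\<lambda>x. ln (w x)) (x' - y' / 2) (x' + y' / 2) - m\<bar> \<le> 3 * y / y' * \<kappa>"
      using y y' by (intro near) (auto simp: a_def b_def abs_le_iff)
    also have "\<dots> \<le> 6 * \<kappa>"
      using y y' \<kappa> by (intro mult_right_mono) (auto simp: field_simps)
    finally show ?thesis .
  qed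
  show "\<bar>log_mean (primitive w) x y - log_mean (primitive w) x' y'\<bar> \<le> 10 * \<kappa>"
    using 1 2 g[OF y(1) order_refl, of x] g[OF y' y(4), of x'] unfolding abs_le_iff by linarith
qed

section \<open>The Carleson density and the doubling ratios\<close>

lemma eta_eq_defect:
  assumes A: "A_infinity_weight w" and y: "0 < y"
  shows "eta w (x, y) = defect (primitive w) x y"
proof -
  note w = weightD(3)[OF A_infinity_weightD[OF A]]
  define F where "F = primitive w"
  have F: "0 < F t - F s" if "s < t" for s t
    using A_infinity_primitive_strict_mono[OF A] that by (simp add: F_def strict_mono_def)
  have m: "wmass w {s<..<t} = F t - F s" if "s < t" for s t
    using that by (simp add: wmass_interval[OF w] F_def)
  define P where "P = F (x + y / 2) - F (x - y / 2)"
  define Q where "Q = F (x + y / 2) - F x"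
  define R where "R = F x - F (x - y / 2)"
  have pos: "0 < P" "0 < Q" "0 < R"
    unfolding P_def Q_def R_def by (rule F; use y in simp)+
  have "eta w (x, y) = ln (inverse 2 * P / (Q powr (1 / 2) * R powr (1 / 2)))"
    using y by (simp add: eta_def m P_def Q_def R_def)
  also have "\<dots> = ln P - ln 2 - (ln Q + ln R) / 2"
    using pos by (simp add: ln_div ln_mult ln_powr ln_inverse add_divide_distrib)
  also have "\<dots> = ln (P / y) - (ln (R / (y / 2)) + ln (Q / (y / 2))) / 2"
    using pos y by (simp add: ln_div ln_mult field_simps)
  also have "\<dots> = defect F x y"
    by (simp add: defect_def log_mean_def P_def Q_def R_def add.commute)
  finally show ?thesis by (simp add: F_def)
qed

lemma carleson_average_eta:
  assumes A: "A_infinity_weight w"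
  shows "carleson_average (\<lambda>(x, y). eta w (x, y) / y) a b =
    (\<integral>\<^sup>+z\<in>{a..b} \<times> {0<..<b - a}. ennreal (case z of (x, y) \<Rightarrow> defect (primitive w) x y / y) \<partial>lebesgue)
      / ennreal (b - a)"
  unfolding carleson_average_def
  by (intro arg_cong2[where f="(/)"] nn_integral_cong refl)
     (auto simp: indicator_def eta_eq_defect[OF A])

lemma carleson_density:
  assumes A: "A_infinity_weight w"
  shows "(\<lambda>(x, y). eta w (x, y) / y) \<in> borel_measurable (lebesgue_on half_plane)"
    and "\<forall>z\<in>half_plane. 0 \<le> (\<lambda>(x, y). eta w (x, y) / y) z"
proof -
  note mono = A_infinity_primitive_strict_mono[OF A]
  note cont = continuous_primitive[OF weightD(3)[OF A_infinity_weightD[OF A]]]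
  have "open {z :: real \<times> real. 0 < snd z}" by (intro open_Collect_less continuous_intros)
  moreover have "{z. 0 < snd z} = half_plane" by (auto simp: half_plane_def)
  ultimately have "open half_plane" by simp
  then have S: "half_plane \<in> sets lebesgue" by (simp add: borel_open)
  have "continuous_on half_plane (\<lambda>z. defect (primitive w) (fst z) (snd z) / snd z)"
    by (intro continuous_on_divide continuous_on_defect[OF mono cont] continuous_intros)
       (auto simp: half_plane_def)
  then have "continuous_on half_plane (\<lambda>(x, y). eta w (x, y) / y)"
    by (rule continuous_on_eq) (auto simp: half_plane_def eta_eq_defect[OF A])
  then show "(\<lambda>(x, y). eta w (x, y) / y) \<in> borel_measurable (lebesgue_on half_plane)"
    by (rule continuous_imp_measurable_on_sets_lebesgue[OF _ S])
  show "\<forall>z\<in>half_plane. 0 \<le> (\<lambda>(x, y). eta w (x, y) / y) z"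
    by (auto simp: half_plane_def eta_eq_defect[OF A] intro!: divide_nonneg_pos defect_nonneg[OF mono cont])
qed

lemma carleson_average_le_of_gap:
  assumes A: "A_infinity_weight w" and u: "locally_integrable (\<lambda>x. ln (w x))"
    and sv: "slowly_varying (primitive w) (b - a) d" and ab: "a < b"
  shows "carleson_average (\<lambda>(x, y). eta w (x, y) / y) a b \<le> ennreal (ln 2 * jensen_gap w a b + 2 * d)"
proof -
  note mono = A_infinity_primitive_strict_mono[OF A]
  note w = weightD(3)[OF A_infinity_weightD[OF A]]
  define U where "U = primitive (\<lambda>x. ln (w x))"
  have le: "(U (x + y / 2) - U (x - y / 2)) / y \<le> log_mean (primitive w) x y" if y: "0 < y" for x y
  proof -
    have "0 \<le> jensen_gap w (x - y / 2) (x + y / 2)"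
      using y by (intro jensen_gap_nonneg w A_infinity_pos_AE A u A_infinity_mean_pos) auto
    then show ?thesis
      using y by (simp add: jensen_gap_def log_mean_primitive[OF w y] mean_eq_primitive[OF u] U_def)
  qed
  have d: "0 \<le> d" using slowly_varyingD[OF sv, of "b - a" "b - a" 0 0] ab by simp
  have gap: "0 \<le> jensen_gap w a b"
    using ab by (intro jensen_gap_nonneg w A_infinity_pos_AE A u A_infinity_mean_pos) auto
  have c: "(a + b) / 2 - (b - a) / 2 = a" "(a + b) / 2 + (b - a) / 2 = b"
    by (simp_all add: field_simps)
  have "(b - a) * ln 2 * log_mean (primitive w) ((a + b) / 2) (b - a) + 2 * d * (b - a) - ln 2 * (U b - U a)
      = (ln 2 * jensen_gap w a b + 2 * d) * (b - a)"
  proof -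
    have 1: "U b - U a = mean (\<lambda>x. ln (w x)) a b * (b - a)"
      using ab by (simp add: U_def mean_eq_primitive[OF u])
    have 2: "log_mean (primitive w) ((a + b) / 2) (b - a) = ln (mean w a b)"
      using log_mean_primitive[OF w, of "b - a" "(a + b) / 2"] ab by (simp add: c)
    show ?thesis unfolding 1 2 by (simp add: jensen_gap_def algebra_simps)
  qed
  then have "carleson_average (\<lambda>(x, y). eta w (x, y) / y) a b
      \<le> ennreal ((ln 2 * jensen_gap w a b + 2 * d) * (b - a)) / ennreal (b - a)"
    unfolding carleson_average_eta[OF A]
    using nn_integral_defect_le_of_minorant[OF mono continuous_primitive[OF w] sv ab continuous_primitive[OF u], folded U_def, OF le]
    by (intro divide_right_mono_ennreal) simp
  also have "\<dots> = ennreal (ln 2 * jensen_gap w a b + 2 * d)"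
    using ab d gap by (subst divide_ennreal) auto
  finally show ?thesis .
qed

lemma oscillation_of_carleson_average:
  assumes A: "A_infinity_weight w" and sv: "slowly_varying (primitive w) (b - a) d" and ab: "a < b"
    and C: "0 \<le> C" "carleson_average (\<lambda>(x, y). eta w (x, y) / y) a b \<le> ennreal C"
  shows "set_integrable lebesgue {a..b} (\<lambda>x. ln (w x))"
    and "0 < s \<Longrightarrow> s \<le> 1 \<Longrightarrow>
      mean_oscillation (\<lambda>x. ln (w x)) a b \<le> 2 * (s + 2 / s * ((2 * d + C) / ln 2))"
proof -
  note W = weightD[OF A_infinity_weightD[OF A]]
  define N where "N = (\<integral>\<^sup>+z\<in>{a..b} \<times> {0<..<b - a}. ennreal (case z of (x, y) \<Rightarrow> defect (primitive w) x y / y) \<partial>lebesgue)"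
  have d: "0 \<le> d" using slowly_varyingD[OF sv, of "b - a" "b - a" 0 0] ab by simp
  have "N = N / ennreal (b - a) * ennreal (b - a)"
    using ab by (simp add: ennreal_divide_times)
  also have "\<dots> \<le> ennreal C * ennreal (b - a)"
    using C(2) unfolding carleson_average_eta[OF A] N_def[symmetric] by (rule mult_right_mono) simp
  also have "\<dots> = ennreal (C * (b - a))"
    using C ab by (simp add: ennreal_mult)
  finally have N: "N \<le> ennreal (C * (b - a))" .
  define l where "l = log_mean (primitive w) ((a + b) / 2) (b - a)"
  define K where "K = (2 * d * (b - a) + C * (b - a)) / ln 2"
  have K: "0 \<le> K" "K / (b - a) = (2 * d + C) / ln 2"
  proof -
    have "K = (2 * d + C) / ln 2 * (b - a)" by (simp add: K_def field_simps)
    then show "0 \<le> K" "K / (b - a) = (2 * d + C) / ln 2" using d C ab by auto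
  qed
  have le: "(\<integral>\<^sup>+x\<in>{a..b}. ennreal (exp (ln (w x) - l) - 1 - (ln (w x) - l)) \<partial>lebesgue) \<le> ennreal K"
    unfolding K_def using C ab
    by (intro nn_integral_deviation_le[OF A_infinity_primitive_strict_mono[OF A] continuous_primitive[OF W(3)] sv ab _
          N[unfolded N_def] l_def AE_primitive_has_derivative[OF W(3)] A_infinity_pos_AE[OF A]]) auto
  have um: "(\<lambda>x. ln (w x)) \<in> borel_measurable lebesgue" using W(1) by measurable
  show "set_integrable lebesgue {a..b} (\<lambda>x. ln (w x))"
    by (rule oscillation_of_exp_deviation(1)[OF um ab K(1) le])
  show "mean_oscillation (\<lambda>x. ln (w x)) a b \<le> 2 * (s + 2 / s * ((2 * d + C) / ln 2))" if "0 < s" "s \<le> 1"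
    using oscillation_of_exp_deviation(2)[OF um ab K(1) le that] by (simp add: K(2))
qed

text \<open>
  Adjacent intervals of length \<open>t\<close> have centres at distance \<open>t\<close>, so slow variation contains the
  doubling condition.
\<close>
lemma log_ratio_le_of_slowly_varying:
  assumes sv: "slowly_varying F h d" and t: "0 < t" "t \<le> h" and F: "strict_mono F"
  shows "F (x + t) - F x \<le> exp d * (F x - F (x - t))" "F x - F (x - t) \<le> exp d * (F (x + t) - F x)"
proof -
  define p where "p = F (x + t) - F x"
  define q where "q = F x - F (x - t)"
  have pos: "0 < p" "0 < q" using F t by (auto simp: p_def q_def strict_mono_def)
  have "\<bar>log_mean F (x + t / 2) t - log_mean F (x - t / 2) t\<bar> \<le> d"
    using t by (intro slowly_varyingD[OF sv]) auto
  moreover have "log_mean F (x + t / 2) t = ln (p / t)" "log_mean F (x - t / 2) t = ln (q / t)"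
    by (simp_all add: log_mean_def p_def q_def add.commute)
  ultimately have "\<bar>ln p - ln q\<bar> \<le> d"
    using pos t by (simp add: ln_div)
  then have "ln p \<le> ln (exp d * q)" "ln q \<le> ln (exp d * p)"
    using pos by (simp_all add: ln_mult abs_le_iff)
  then have "p \<le> exp d * q" "q \<le> exp d * p"
    using pos by simp_all
  then show "F (x + t) - F x \<le> exp d * (F x - F (x - t))" "F x - F (x - t) \<le> exp d * (F (x + t) - F x)"
    by (simp_all only: p_def q_def)
qed

section \<open>From vanishing oscillation to vanishing Carleson measure and doubling\<close>

text \<open>
  A common bound \<open>\<kappa>\<close> for gaps and oscillations on the intervals of length at most \<open>3 * h\<close> controls ratios
  and Carleson averages on those of length at most \<open>h\<close>.  Bounded oscillation gives one \<open>\<kappa>\<close> for every \<open>h\<close>, and vanishing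
  oscillation gives arbitrarily small \<open>\<kappa>\<close> for short intervals.
\<close>
lemma VMO_imp_vanishing:
  assumes A: "A_infinity_weight w" and V: "(\<lambda>x. ln (w x)) \<in> VMO"
  shows "vanishing_carleson_measure (\<lambda>(x, y). eta w (x, y) / y)" "vanishing_doubling_weight w"
proof -
  note w = weightD(3)[OF A_infinity_weightD[OF A]]
  note mono = A_infinity_primitive_strict_mono[OF A]
  define u where "u = (\<lambda>x. ln (w x))"
  define F where "F = primitive w"
  have u: "locally_integrable u" using V by (simp add: VMO_def BMO_def u_def)
  obtain C where C: "\<And>a b. a < b \<Longrightarrow> mean_oscillation u a b \<le> C"
    using V unfolding VMO_def BMO_def u_def by auto
  have vmo: "\<exists>\<delta>>0. \<forall>a b. a < b \<and> b - a < \<delta> \<longrightarrow> mean_oscillation u a b < \<epsilon>" if "0 < \<epsilon>" for \<epsilon>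
    using V that unfolding VMO_def u_def by blast
  have bound: "slowly_varying F h (10 * \<kappa>)"
      "\<And>a b. a < b \<Longrightarrow> b - a \<le> h \<Longrightarrow> carleson_average (\<lambda>(x, y). eta w (x, y) / y) a b \<le> ennreal (21 * \<kappa>)"
    if gap: "\<And>a b. a < b \<Longrightarrow> b - a \<le> 3 * h \<Longrightarrow> jensen_gap w a b \<le> \<kappa>"
      and osc: "\<And>a b. a < b \<Longrightarrow> b - a \<le> 3 * h \<Longrightarrow> mean_oscillation u a b \<le> \<kappa>" for h \<kappa>
  proof -
    show sv: "slowly_varying F h (10 * \<kappa>)"
      unfolding F_def using gap osc by (intro slowly_varying_of_jensen_gap A u[unfolded u_def]) (auto simp: u_def)
    fix a b :: real assume ab: "a < b" "b - a \<le> h"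
    have sv': "slowly_varying F (b - a) (10 * \<kappa>)"
      using sv ab unfolding slowly_varying_def by (meson order_trans)
    have g: "0 \<le> jensen_gap w a b" "jensen_gap w a b \<le> \<kappa>"
      using ab by (auto intro!: gap jensen_gap_nonneg w A_infinity_pos_AE A u[unfolded u_def] A_infinity_mean_pos)
    have "ln 2 * jensen_gap w a b \<le> 1 * \<kappa>"
      using g ln_2_less_1 by (intro mult_mono) auto
    then have "ennreal (ln 2 * jensen_gap w a b + 2 * (10 * \<kappa>)) \<le> ennreal (21 * \<kappa>)"
      by (intro ennreal_leI) simp
    with carleson_average_le_of_gap[OF A u[unfolded u_def] sv'[unfolded F_def] ab(1)]
    show "carleson_average (\<lambda>(x, y). eta w (x, y) / y) a b \<le> ennreal (21 * \<kappa>)"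
      by (rule order_trans)
  qed
  have global: "\<exists>\<kappa>. \<forall>a b. a < b \<longrightarrow> jensen_gap w a b \<le> \<kappa> \<and> mean_oscillation u a b \<le> \<kappa>"
  proof -
    obtain \<delta> where \<delta>: "0 < \<delta>" "\<And>a b \<tau>. a < b \<Longrightarrow> 0 < \<tau> \<Longrightarrow> mean_oscillation u a b \<le> \<tau> * \<delta> \<Longrightarrow>
       jensen_gap w a b \<le> \<tau> - ln (1 - 1 / 2)"
      using A_infinity_jensen_gap_le[OF A u[unfolded u_def], of "1 / 2"] unfolding u_def by auto
    define \<tau> where "\<tau> = max 1 (C / \<delta>)"
    have \<tau>: "0 < \<tau>" by (simp add: \<tau>_def)
    have "C / \<delta> \<le> \<tau>" by (simp add: \<tau>_def)
    then have "C \<le> \<tau> * \<delta>" using \<delta>(1) by (simp add: field_simps)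
    then have "jensen_gap w a b \<le> \<tau> - ln (1 - 1 / 2)" if "a < b" for a b
      using \<delta>(2)[OF that \<tau>] C[OF that] by linarith
    then show ?thesis
      using C by (intro exI[of _ "max C (\<tau> - ln (1 - 1 / 2))"]) (auto simp: le_max_iff_disj)
  qed
  have local: "\<exists>h>0. \<forall>a b. a < b \<and> b - a \<le> 3 * h \<longrightarrow> jensen_gap w a b \<le> \<kappa> \<and> mean_oscillation u a b \<le> \<kappa>"
    if \<kappa>: "0 < \<kappa>" for \<kappa>
  proof -
    \<comment> \<open>Half of \<open>\<kappa>\<close> is allotted to \<open>- ln (1 - \<epsilon>)\<close>, the other half to the threshold \<open>\<tau>\<close>.\<close>
    define \<epsilon> where "\<epsilon> = 1 - exp (- \<kappa> / 2)"
    have \<epsilon>: "0 < \<epsilon>" "\<epsilon> < 1" "ln (1 - \<epsilon>) = - \<kappa> / 2" using \<kappa> by (simp_all add: \<epsilon>_def)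
    obtain \<delta> where \<delta>: "0 < \<delta>" "\<And>a b \<tau>. a < b \<Longrightarrow> 0 < \<tau> \<Longrightarrow> mean_oscillation u a b \<le> \<tau> * \<delta> \<Longrightarrow>
       jensen_gap w a b \<le> \<tau> - ln (1 - \<epsilon>)"
      using A_infinity_jensen_gap_le[OF A u[unfolded u_def] \<epsilon>(1,2)] unfolding u_def by auto
    obtain r where r: "0 < r" "\<And>a b. a < b \<Longrightarrow> b - a < r \<Longrightarrow> mean_oscillation u a b < min \<kappa> (\<kappa> / 2 * \<delta>)"
      using vmo[of "min \<kappa> (\<kappa> / 2 * \<delta>)"] \<kappa> \<delta>(1) by auto
    have "jensen_gap w a b \<le> \<kappa> \<and> mean_oscillation u a b \<le> \<kappa>" if "a < b" "b - a \<le> 3 * (r / 4)" for a b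
    proof -
      have o: "mean_oscillation u a b < min \<kappa> (\<kappa> / 2 * \<delta>)"
        using that r by (intro r(2)) auto
      then have "jensen_gap w a b \<le> \<kappa> / 2 - ln (1 - \<epsilon>)"
        using that \<kappa> by (intro \<delta>(2)) auto
      with o show ?thesis by (simp add: \<epsilon>(3))
    qed
    then show ?thesis using r(1) by (intro exI[of _ "r / 4"]) auto
  qed
  obtain \<kappa> where \<kappa>: "\<And>a b. a < b \<Longrightarrow> jensen_gap w a b \<le> \<kappa>" "\<And>a b. a < b \<Longrightarrow> mean_oscillation u a b \<le> \<kappa>"
    using global by blast
  have mass: "wmass w {x..x + t} = F (x + t) - F x" "wmass w {x - t..x} = F x - F (x - t)"
    "wmass w {x<..<x + t} = F (x + t) - F x" "wmass w {x - t<..<x} = F x - F (x - t)"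
    if "0 < t" for x t
    using that by (simp_all add: wmass_interval[OF w] F_def)
  note ratio = log_ratio_le_of_slowly_varying[OF _ _ _ mono, folded F_def]
  have "doubling_weight w"
    unfolding doubling_weight_def
  proof (intro conjI A_infinity_weightD[OF A] exI[of _ "exp (10 * \<kappa>)"] allI impI)
    fix x t :: real assume t: "0 < t"
    have sv: "slowly_varying F t (10 * \<kappa>)" by (intro bound(1) \<kappa>)
    show "inverse (exp (10 * \<kappa>)) * wmass w {x..x + t} \<le> wmass w {x - t..x}"
      unfolding mass[OF t] using ratio(1)[OF sv t order_refl, of x] by (simp add: field_simps)
    show "wmass w {x - t..x} \<le> exp (10 * \<kappa>) * wmass w {x..x + t}"
      using ratio(2)[OF sv t order_refl, of x] by (simp add: mass[OF t])
  qed simp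
  then show "vanishing_doubling_weight w"
    unfolding vanishing_doubling_weight_def
  proof (intro conjI allI impI)
    fix \<epsilon> :: real assume \<epsilon>: "0 < \<epsilon>"
    define k where "k = ln (1 + \<epsilon>) / 10"
    have k: "0 < k" "exp (10 * k) = 1 + \<epsilon>" using \<epsilon> by (simp_all add: k_def)
    obtain h where h: "0 < h" "\<And>a b. a < b \<Longrightarrow> b - a \<le> 3 * h \<Longrightarrow> jensen_gap w a b \<le> k"
      "\<And>a b. a < b \<Longrightarrow> b - a \<le> 3 * h \<Longrightarrow> mean_oscillation u a b \<le> k"
      using local[OF k(1)] by blast
    have sv: "slowly_varying F h (10 * k)" by (intro bound(1) h)
    have "inverse (1 + \<epsilon>) \<le> wmass w {x<..<x + t} / wmass w {x - t<..<x} \<and>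
        wmass w {x<..<x + t} / wmass w {x - t<..<x} \<le> 1 + \<epsilon>" if t: "0 < t" "t < h" for x t
    proof -
      have "0 < F x - F (x - t)" using mono t by (simp add: F_def strict_mono_def)
      then show ?thesis
        using ratio[OF sv t(1) less_imp_le[OF t(2)], of x] \<epsilon>
        unfolding mass[OF t(1)] k(2) by (simp add: field_simps)
    qed
    then show "\<exists>\<delta>>0. \<forall>x t. 0 < t \<and> t < \<delta> \<longrightarrow>
        inverse (1 + \<epsilon>) \<le> wmass w {x<..<x + t} / wmass w {x - t<..<x} \<and>
        wmass w {x<..<x + t} / wmass w {x - t<..<x} \<le> 1 + \<epsilon>"
      using h(1) by (intro exI[of _ h]) blast
  qed
  have "(SUP (a, b)\<in>{(a, b). a < b}. carleson_average (\<lambda>(x, y). eta w (x, y) / y) a b) \<le> ennreal (21 * \<kappa>)"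
  proof (rule SUP_least, clarify)
    fix a b :: real assume "a < b"
    then show "carleson_average (\<lambda>(x, y). eta w (x, y) / y) a b \<le> ennreal (21 * \<kappa>)"
      by (intro bound(2)[of "b - a"] \<kappa>) auto
  qed
  also have "\<dots> < \<infinity>" by simp
  finally have "carleson_measure (\<lambda>(x, y). eta w (x, y) / y)"
    unfolding carleson_measure_def using carleson_density[OF A] by blast
  then show "vanishing_carleson_measure (\<lambda>(x, y). eta w (x, y) / y)"
    unfolding vanishing_carleson_measure_def
  proof (intro conjI allI impI)
    fix \<epsilon> :: real assume \<epsilon>: "0 < \<epsilon>"
    define k where "k = \<epsilon> / 42"
    have k: "0 < k" "21 * k < \<epsilon>" using \<epsilon> by (simp_all add: k_def)
    obtain h where h: "0 < h" "\<And>a b. a < b \<Longrightarrow> b - a \<le> 3 * h \<Longrightarrow> jensen_gap w a b \<le> k"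
      "\<And>a b. a < b \<Longrightarrow> b - a \<le> 3 * h \<Longrightarrow> mean_oscillation u a b \<le> k"
      using local[OF k(1)] by blast
    have "carleson_average (\<lambda>(x, y). eta w (x, y) / y) a b < ennreal \<epsilon>" if "a < b" "b - a < h" for a b
    proof -
      have "carleson_average (\<lambda>(x, y). eta w (x, y) / y) a b \<le> ennreal (21 * k)"
        using that by (intro bound(2)[of h] h) auto
      also have "\<dots> < ennreal \<epsilon>" using k \<epsilon> by (intro ennreal_lessI) auto
      finally show ?thesis .
    qed
    then show "\<exists>\<delta>>0. \<forall>a b. a < b \<and> b - a < \<delta> \<longrightarrow> carleson_average (\<lambda>(x, y). eta w (x, y) / y) a b < ennreal \<epsilon>"
      using h(1) by blast
  qed
qed

section \<open>From vanishing Carleson measure and doubling to vanishing oscillation\<close>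

text \<open>
  The doubling property makes the logarithmic means slowly varying with one constant at all scales, and the
  vanishing of the ratios makes this constant small at small scales; in both regimes
  \<open>oscillation_of_carleson_average\<close> turns Carleson averages into oscillations.
\<close>
lemma vanishing_imp_VMO:
  assumes A: "A_infinity_weight w"
    and carl: "vanishing_carleson_measure (\<lambda>(x, y). eta w (x, y) / y)"
    and doub: "vanishing_doubling_weight w"
  shows "(\<lambda>x. ln (w x)) \<in> VMO"
proof -
  note w = weightD(3)[OF A_infinity_weightD[OF A]]
  define u where "u = (\<lambda>x. ln (w x))"
  define F where "F = primitive w"
  have mono: "strict_mono F" and cont: "continuous_on UNIV F"
    unfolding F_def by (rule A_infinity_primitive_strict_mono[OF A], rule continuous_primitive[OF w])
  have pos: "0 < F (x + t) - F x" "0 < F x - F (x - t)" if "0 < t" for x t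
    using mono that by (auto simp: strict_mono_def)
  have mass: "wmass w {x..x + t} = F (x + t) - F x" "wmass w {x - t..x} = F x - F (x - t)"
    "wmass w {x<..<x + t} = F (x + t) - F x" "wmass w {x - t<..<x} = F x - F (x - t)"
    if "0 < t" for x t
    using that by (simp_all add: wmass_interval[OF w] F_def)
  have sv_global: "\<exists>d. \<forall>h. slowly_varying F h d"
  proof -
    obtain \<rho> where \<rho>: "0 < \<rho>" "\<And>x t. 0 < t \<Longrightarrow> inverse \<rho> * wmass w {x..x + t} \<le> wmass w {x - t..x}"
       "\<And>x t. 0 < t \<Longrightarrow> wmass w {x - t..x} \<le> \<rho> * wmass w {x..x + t}"
      using doub unfolding vanishing_doubling_weight_def doubling_weight_def by blast
    have r: "\<bar>ln (F (x + t) - F x) - ln (F x - F (x - t))\<bar> \<le> ln \<rho>" if t: "0 < t" for x t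
    proof -
      define p where "p = F (x + t) - F x"
      define q where "q = F x - F (x - t)"
      have pq: "0 < p" "0 < q" using pos[OF t] by (simp_all add: p_def q_def)
      have "p \<le> \<rho> * q" "q \<le> \<rho> * p"
        using \<rho>(1) \<rho>(2,3)[OF t, of x] unfolding mass[OF t] p_def[symmetric] q_def[symmetric]
        by (simp_all add: field_simps)
      then have "ln p \<le> ln (\<rho> * q)" "ln q \<le> ln (\<rho> * p)"
        using pq \<rho>(1) by (auto intro: ln_mono)
      then have "\<bar>ln p - ln q\<bar> \<le> ln \<rho>"
        using pq \<rho>(1) by (simp add: ln_mult abs_le_iff)
      then show ?thesis by (simp only: p_def q_def)
    qed
    have "0 \<le> ln \<rho>" using r[of 1 0] by linarith
    \<comment> \<open>Any number of cells above 12 gives a finite bound.\<close>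
    then have "slowly_varying F h (2 * (real 13 * ln \<rho> - ln (1 - 12 / real 13)))" for h
      using r by (intro slowly_varying_of_ratios[OF mono cont]) auto
    then show ?thesis by blast
  qed
  have sv_local: "\<exists>h0>0. \<forall>h<h0. slowly_varying F h d" if d: "0 < d" for d
  proof -
    have "(\<lambda>N. - ln (1 - 12 / real N)) \<longlonglongrightarrow> - ln (1 - 0)"
      by (intro tendsto_intros lim_const_over_n) auto
    then have "\<forall>\<^sub>F N in sequentially. - ln (1 - 12 / real N) < d / 4"
      using d by (intro order_tendstoD(2)) auto
    then obtain N :: nat where N: "12 < N" "- ln (1 - 12 / real N) < d / 4"
      using eventually_happens[OF eventually_conj[OF eventually_gt_at_top[of 12]]] by fastforce
    define q where "q = d / (4 * real N)"
    have q: "0 < q" "real N * q = d / 4" using d N by (auto simp: q_def)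
    obtain \<delta> where \<delta>: "0 < \<delta>" "\<And>x t. 0 < t \<Longrightarrow> t < \<delta> \<Longrightarrow>
        inverse (exp q) \<le> wmass w {x<..<x + t} / wmass w {x - t<..<x} \<and>
        wmass w {x<..<x + t} / wmass w {x - t<..<x} \<le> exp q"
    proof -
      have "0 < exp q - 1" using q by simp
      then obtain \<delta> where "0 < \<delta>" "\<forall>x t. 0 < t \<and> t < \<delta> \<longrightarrow>
        inverse (1 + (exp q - 1)) \<le> wmass w {x<..<x + t} / wmass w {x - t<..<x} \<and>
        wmass w {x<..<x + t} / wmass w {x - t<..<x} \<le> 1 + (exp q - 1)"
        using doub unfolding vanishing_doubling_weight_def by blast
      then show thesis using that by simp
    qed
    have "slowly_varying F h d" if h: "h < \<delta>" for h
    proof -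
      have "slowly_varying F h (2 * (real N * q - ln (1 - 12 / real N)))"
      proof (rule slowly_varying_of_ratios[OF mono cont N(1) less_imp_le[OF q(1)]])
        fix x t :: real assume t: "0 < t" "t \<le> 3 * h / real N"
        have "0 < 3 * h / real N" using t by simp
        then have "0 < h" using N by (simp add: zero_less_divide_iff)
        then have "3 * h / real N \<le> h" using N by (simp add: field_simps)
        with t h have "t < \<delta>" by simp
        define r where "r = (F (x + t) - F x) / (F x - F (x - t))"
        have r: "0 < r" "ln r = ln (F (x + t) - F x) - ln (F x - F (x - t))"
          using pos[OF t(1), of x] by (simp_all add: r_def ln_div)
        have "exp (- q) \<le> r" "r \<le> exp q"
          using \<delta>(2)[OF t(1) \<open>t < \<delta>\<close>, of x] by (simp_all add: mass[OF t(1)] r_def exp_minus)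
        then have "ln (exp (- q)) \<le> ln r" "ln r \<le> ln (exp q)"
          by (intro ln_mono; use r(1) in simp)+
        then show "\<bar>ln (F (x + t) - F x) - ln (F x - F (x - t))\<bar> \<le> q"
          by (simp add: r(2)[symmetric] abs_le_iff)
      qed
      moreover have "2 * (real N * q - ln (1 - 12 / real N)) \<le> d" using N q by simp
      ultimately show ?thesis unfolding slowly_varying_def by (meson order_trans)
    qed
    then show ?thesis using \<delta>(1) by blast
  qed
  obtain D where D: "\<And>h. slowly_varying F h D" using sv_global by blast
  define S where "S = (SUP (a, b)\<in>{(a, b). a < b}. carleson_average (\<lambda>(x, y). eta w (x, y) / y) a b)"
  define C where "C = enn2real S"
  have "S < \<infinity>"
    using carl unfolding vanishing_carleson_measure_def carleson_measure_def S_def by blast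
  then have C: "0 \<le> C" "S = ennreal C"
    by (simp_all add: C_def ennreal_enn2real)
  have avg: "carleson_average (\<lambda>(x, y). eta w (x, y) / y) a b \<le> ennreal C" if "a < b" for a b
    unfolding C(2)[symmetric] S_def using that by (intro SUP_upper2[of "(a, b)"]) auto
  have int: "set_integrable lebesgue {a..b} u" for a b
  proof (cases "a < b")
    case True
    show ?thesis
      unfolding u_def by (rule oscillation_of_carleson_average(1)[OF A D[unfolded F_def] True C(1) avg[OF True]])
  next
    case False
    then have "negligible {a..b}" by (auto simp: not_less le_less)
    then show ?thesis using absolutely_integrable_negligible by blast
  qed
  have "locally_integrable u"
    unfolding locally_integrable_def
  proof (intro allI impI)
    fix K :: "real set" assume K: "compact K"
    then obtain a where "K \<subseteq> {-a..a}"
      using bounded_subset_cbox_symmetric[of K] by (auto simp: compact_imp_bounded)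
    then show "set_integrable lebesgue K u"
      by (rule set_integrable_subset[OF int fmeasurableD[OF lmeasurable_compact[OF K]]])
  qed
  moreover have "mean_oscillation u a b \<le> 2 * (1 + 2 / 1 * ((2 * D + C) / ln 2))" if "a < b" for a b
    unfolding u_def
    by (rule oscillation_of_carleson_average(2)[OF A D[unfolded F_def] that C(1) avg[OF that]]) auto
  ultimately have bmo: "u \<in> BMO" unfolding BMO_def by blast
  have "\<exists>\<delta>>0. \<forall>a b. a < b \<and> b - a < \<delta> \<longrightarrow> mean_oscillation u a b < \<epsilon>" if \<epsilon>: "0 < \<epsilon>" for \<epsilon>
  proof -
    define s where "s = min 1 (\<epsilon> / 8)"
    have s: "0 < s" "s \<le> 1" "s \<le> \<epsilon> / 8" using \<epsilon> by (auto simp: s_def)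
    \<comment> \<open>Chosen so that \<open>2 * (2 / s) * (3 * q / ln 2) = \<epsilon> / 4\<close>.\<close>
    define q where "q = s * \<epsilon> * ln 2 / 48"
    have q: "0 < q" using s \<epsilon> by (simp add: q_def)
    obtain h where h: "0 < h" "\<And>h'. h' < h \<Longrightarrow> slowly_varying F h' q"
      using sv_local[OF q] by blast
    obtain r where r: "0 < r" "\<And>a b. a < b \<Longrightarrow> b - a < r \<Longrightarrow>
        carleson_average (\<lambda>(x, y). eta w (x, y) / y) a b < ennreal q"
      using carl q unfolding vanishing_carleson_measure_def by blast
    have "mean_oscillation u a b < \<epsilon>" if ab: "a < b" "b - a < min h r" for a b
    proof -
      have "mean_oscillation u a b \<le> 2 * (s + 2 / s * ((2 * q + q) / ln 2))"
        unfolding u_def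
        using ab h(2)[of "b - a"] r(2)[of a b] q s
        by (intro oscillation_of_carleson_average(2)[OF A]) (auto simp: F_def)
      also have "\<dots> = 2 * s + \<epsilon> / 4"
        using s by (simp add: q_def field_simps)
      also have "\<dots> < \<epsilon>" using s \<epsilon> by simp
      finally show ?thesis .
    qed
    then show ?thesis using h(1) r(1) by (intro exI[of _ "min h r"]) auto
  qed
  with bmo show ?thesis unfolding VMO_def u_def by blast
qed

theorem theorem1:
  fixes w :: "real \<Rightarrow> real"
  assumes "A_infinity_weight w"
  shows "(\<lambda>x. ln (w x)) \<in> VMO \<longleftrightarrow>
           vanishing_carleson_measure (\<lambda>(x, y). eta w (x, y) / y) \<and>
           vanishing_doubling_weight w"
  using VMO_imp_vanishing[OF assms] vanishing_imp_VMO[OF assms] by blast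

end
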